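(* Consider an allocation problem with $n$ agents and item set $\mathcal{M}$, let $\varepsilon>0$, and let $X=(X_1,\dots,X_n)$ be an allocation of $\mathcal{M}$ with $\mathrm{NW}(X)=\mathrm{opt}(\mathcal{M})$ that satisfies the large market condition with parameter $\varepsilon$: $v_i(g)\le\varepsilon\cdot v_i(X_i)$ for every agent $i\in[n]$ and every item $g\in X_i$. Then Algorithm 1 with input $X$ outputs an EFX allocation $Y$ of a subset of $\mathcal{M}$ that is $(1+8\sqrt{\varepsilon})$-efficient, i.e. $(1+8\sqrt{\varepsilon})\cdot\mathrm{NW}(Y)\ge\mathrm{opt}(\mathcal{M})$.
   Context: Allocation problem: agents $[n]=\{1,\dots,n\}$, a finite set $\mathcal{M}$ of indivisible items, valuations $v_i:\mathcal{M}\to\mathbb{R}_+$ (positive reals), extended additively: $v_i(S)=\sum_{g\in S}v_i(g)$. An allocation of $S\subseteq\mathcal{M}$ is an ordered partition $X=(X_1,\dots,X_n)$ of $S$ into $n$ pairwise disjoint (possibly empty) bundles; agent $i$ gets $X_i$. $X$ is EFX if $v_i(X_i)\ge\max_{g\in X_j}v_i(X_j\setminus\{g\})$ for all $i,j\in[n]$ (a maximum over an empty bundle is $0$). $\mathrm{NW}(X)=\left(\prod_{i}v_i(X_i)\right)^{1/n}$; $\mathrm{opt}(S)$ is the maximum of $\mathrm{NW}$ over allocations of $S$. An allocation $Y$ of $S\subseteq\mathcal{M}$ is $\alpha$-efficient if $\alpha\cdot\mathrm{NW}(Y)\ge\mathrm{opt}(\mathcal{M})$. Algorithm 1. Input: an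 allocation $X$ of $\mathcal{M}$ with $\mathrm{NW}(X)=\mathrm{opt}(\mathcal{M})$. Maintain an indexed family of bundles $Z=(Z_1,\dots,Z_n)$, initially $Z=X$. A bundle $Z_j$ is called touched if at least one item has been removed from it. The EFX feasibility graph of $Z$ is the bipartite graph $G$ with vertex parts $[n]$ (agents) and $\{Z_1,\dots,Z_n\}$ (bundles, as $n$ distinct vertices), with an edge $(i,Z_j)$ if and only if (i) $Z_j$ is EFX feasible for $i$, i.e. $v_i(Z_j)\ge\max_{g\in Z_k}v_i(Z_k\setminus\{g\})$ for all $k\in[n]$, and (ii) if $i\ne j$ then $v_i(Z_j)>v_i(Z_i)$. The robust demand of agent $i$ is any bundle $Z_j$ maximizing $\max_{c\in Z_j}v_i(Z_j\setminus\{c\})$ over all bundles (ties broken arbitrarily). In each iteration: build $G$ for the current $Z$; let $T$ be the set of touched bundles; choose a matching $M$ in $G$ such that (a) all bundles in $T$ are matched, (b) subject to (a), $|M\cap\{(i,Z_i):i\in[n]\}|$ is maximum, (c) subject to (a) and (b), $|M|$ is maximum. If $|M|=n$, stop and return $Y$, where $Y_i$ is the bundle matched to agent $i$ in $M$. Otherwise pick an arbitrary agent $i$ not matched in $M$, let $Z_j$ be the robust demand of $i$, remove from $Z_j$ an item of minimum value for agent $i$ among the items of $Z_j$, and go to the next iteration. *)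

theory Defs
  imports Complex_Main "HOL-Library.Disjoint_Sets"
begin

text \<open>
  The agents are \<open>{1..n}\<close>. An indexed family of bundles is a function on \<open>nat\<close>, of which only the
  values on \<open>{1..n}\<close> matter.
\<close>

type_synonym 'a valuations = "nat \<Rightarrow> 'a \<Rightarrow> real"
type_synonym 'a bundles = "nat \<Rightarrow> 'a set"

definition bundle_value :: "'a valuations \<Rightarrow> nat \<Rightarrow> 'a set \<Rightarrow> real" where
  "bundle_value v i S = (\<Sum>g\<in>S. v i g)"

definition robust_value :: "'a valuations \<Rightarrow> nat \<Rightarrow> 'a set \<Rightarrow> real" where
  "robust_value v i S =
    (if S = {} then 0 else Max ((\<lambda>g. bundle_value v i (S - {g})) ` S))"

definition allocation :: "nat \<Rightarrow> 'a set \<Rightarrow> 'a bundles \<Rightarrow> bool" where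
  "allocation n S X \<longleftrightarrow> disjoint_family_on X {1..n} \<and> (\<Union>i\<in>{1..n}. X i) = S"

definition EFX :: "nat \<Rightarrow> 'a valuations \<Rightarrow> 'a bundles \<Rightarrow> bool" where
  "EFX n v X \<longleftrightarrow>
    (\<forall>i\<in>{1..n}. \<forall>j\<in>{1..n}. bundle_value v i (X i) \<ge> robust_value v i (X j))"

definition NW :: "nat \<Rightarrow> 'a valuations \<Rightarrow> 'a bundles \<Rightarrow> real" where
  "NW n v X = (\<Prod>i\<in>{1..n}. bundle_value v i (X i)) powr (1 / real n)"

definition opt_NW :: "nat \<Rightarrow> 'a valuations \<Rightarrow> 'a set \<Rightarrow> real" where
  "opt_NW n v S = Max (NW n v ` {X. allocation n S X})"

definition efficient :: "nat \<Rightarrow> 'a valuations \<Rightarrow> 'a set \<Rightarrow> real \<Rightarrow> 'a bundles \<Rightarrow> bool" where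
  "efficient n v \<M> \<alpha> Y \<longleftrightarrow> \<alpha> * NW n v Y \<ge> opt_NW n v \<M>"

definition EFX_feasible :: "nat \<Rightarrow> 'a valuations \<Rightarrow> 'a bundles \<Rightarrow> nat \<Rightarrow> nat \<Rightarrow> bool" where
  "EFX_feasible n v Z i j \<longleftrightarrow>
    (\<forall>k\<in>{1..n}. bundle_value v i (Z j) \<ge> robust_value v i (Z k))"

text \<open>
  The pair \<open>(i, j)\<close> stands for the edge between agent \<open>i\<close> and bundle \<open>Z j\<close>; bundles are identified
  with their indices, so that equal bundles with different indices are different vertices.
\<close>

definition feasibility_graph :: "nat \<Rightarrow> 'a valuations \<Rightarrow> 'a bundles \<Rightarrow> (nat \<times> nat) set" where
  "feasibility_graph n v Z =
    {(i, j). i \<in> {1..n} \<and> j \<in> {1..n} \<and> EFX_feasible n v Z i j \<and>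
       (i \<noteq> j \<longrightarrow> bundle_value v i (Z j) > bundle_value v i (Z i))}"

definition matching :: "(nat \<times> nat) set \<Rightarrow> (nat \<times> nat) set \<Rightarrow> bool" where
  "matching G M \<longleftrightarrow> M \<subseteq> G \<and> inj_on fst M \<and> inj_on snd M"

definition covering_matching ::
    "nat \<Rightarrow> 'a valuations \<Rightarrow> 'a bundles \<Rightarrow> nat set \<Rightarrow> (nat \<times> nat) set \<Rightarrow> bool" where
  "covering_matching n v Z T M \<longleftrightarrow> matching (feasibility_graph n v Z) M \<and> T \<subseteq> snd ` M"

definition selectable_matching ::
    "nat \<Rightarrow> 'a valuations \<Rightarrow> 'a bundles \<Rightarrow> nat set \<Rightarrow> (nat \<times> nat) set \<Rightarrow> bool" where
  "selectable_matching n v Z T =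
    is_arg_max card (is_arg_max (\<lambda>M. card (M \<inter> Id)) (covering_matching n v Z T))"

definition robust_demand :: "nat \<Rightarrow> 'a valuations \<Rightarrow> 'a bundles \<Rightarrow> nat \<Rightarrow> nat \<Rightarrow> bool" where
  "robust_demand n v Z i = is_arg_max (\<lambda>j. robust_value v i (Z j)) (\<lambda>j. j \<in> {1..n})"

text \<open>
  The algorithm is nondeterministic. Each arbitrary choice (of the matching, of the unmatched agent,
  of the robust demand, of the item) is a transition of its own, so that a sequence of choices after
  which the next choice is impossible shows up as a configuration other than \<open>Output\<close> without
  successor. The set \<open>T\<close> contains the indices of the touched bundles.
\<close>

datatype 'a config =
    Iteration "'a bundles" "nat set"
  | Matched "'a bundles" "nat set" "(nat \<times> nat) set"
  | Unmatched_Agent "'a bundles" "nat set" nat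
  | Demand "'a bundles" "nat set" nat nat
  | Output "'a bundles"

inductive step :: "nat \<Rightarrow> 'a valuations \<Rightarrow> 'a config \<Rightarrow> 'a config \<Rightarrow> bool"
  for n :: nat and v :: "'a valuations" where
  choose_matching:
    "selectable_matching n v Z T M \<Longrightarrow> step n v (Iteration Z T) (Matched Z T M)"
| stop:
    "card M = n \<Longrightarrow> (\<And>i j. (i, j) \<in> M \<Longrightarrow> Y i = Z j) \<Longrightarrow> step n v (Matched Z T M) (Output Y)"
| choose_agent:
    "card M \<noteq> n \<Longrightarrow> i \<in> {1..n} \<Longrightarrow> i \<notin> fst ` M \<Longrightarrow>
      step n v (Matched Z T M) (Unmatched_Agent Z T i)"
| choose_demand:
    "robust_demand n v Z i j \<Longrightarrow> step n v (Unmatched_Agent Z T i) (Demand Z T i j)"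
| remove_item:
    "is_arg_min (v i) (\<lambda>g. g \<in> Z j) g \<Longrightarrow>
      step n v (Demand Z T i j) (Iteration (Z(j := Z j - {g})) (insert j T))"

definition initial :: "'a bundles \<Rightarrow> 'a config" where
  "initial X = Iteration X {}"

text \<open>
  Total correctness over all resolutions of the choices: every run from input \<open>X\<close> is finite, and it
  can only end by returning a family of bundles that satisfies \<open>P\<close>.
\<close>

definition algorithm_outputs ::
    "nat \<Rightarrow> 'a valuations \<Rightarrow> 'a bundles \<Rightarrow> ('a bundles \<Rightarrow> bool) \<Rightarrow> bool" where
  "algorithm_outputs n v X P \<longleftrightarrow>
    (\<nexists>c. c 0 = initial X \<and> (\<forall>k::nat. step n v (c k) (c (Suc k)))) \<and>
    (\<forall>c. (step n v)\<^sup>*\<^sup>* (initial X) c \<and> (\<nexists>c'. step n v c c') \<longrightarrow> (\<exists>Y. c = Output Y \<and> P Y))"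

end

theory Submission imports Defs begin

text \<open>
  When an unmatched agent \<open>i\<close> shrinks its robust demand \<open>Z j\<close>, the smaller bundle becomes feasible and
  strictly better for \<open>i\<close> than \<open>Z i\<close>, for otherwise \<open>(i, i)\<close> would be an edge and could be added to the
  matching (evicting the partner of \<open>Z i\<close>), which improves criterion (b). So rematching \<open>Z j\<close> to \<open>i\<close>
  keeps all touched bundles matched, and the run goes on until it stops.

  For efficiency, follow the matching from a bundle \<open>j\<close> that is matched to another agent: \<open>b 0 = j\<close>, and
  \<open>b (t + 1)\<close> is the agent matched to the bundle of \<open>b t\<close>, which it strictly prefers to its own. The
  chain cannot close up, since moving the bundles along the cycle would increase the Nash welfare
  of \<open>X\<close>; hence it reaches an untouched bundle \<open>b m\<close>. Let \<open>kept t\<close> be the value that agent \<open>b t\<close> assigns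
  to its current bundle, relative to its bundle in \<open>X\<close>. Shifting whole bundles along the chain gives
  \<open>kept 0 \<ge> 1/2\<close>, which suffices for \<open>\<epsilon> \<ge> 1/64\<close>. For small \<open>\<epsilon>\<close>, exchanging single items shows that
  \<open>kept t \<ge> (1 - \<epsilon>) * kept (t + 1)\<close>, which settles chains of length below \<open>2 L\<close> with
  \<open>L\<close> about \<open>1 / (2 sqrt \<epsilon>)\<close>. On a longer chain, shift fractions of the bundles that ramp up linearly from
  \<open>1/L\<close> to \<open>1\<close> over the first \<open>L\<close> agents and down again over the last \<open>L\<close>. The agents in between do not
  lose, and the losses of the first \<open>L\<close> agents can be paired with the gains of the last \<open>L\<close>, which exceed
  them unless \<open>kept 0\<close> is within \<open>O(sqrt \<epsilon>)\<close> of \<open>1\<close>.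
\<close>

section \<open>Preliminaries: dense subsets, orbits of injections, a numerical estimate\<close>

text \<open>Among the subsets of \<open>p\<close>-weight at least \<open>w * sum p Z\<close> whose
  ratio of \<open>q\<close> to \<open>p\<close> is no worse than that of \<open>Z\<close>, take one
  of least cardinality. If it overshot by more than \<open>e\<close>, an item of at most average
  density could be dropped. The exact endpoint \<open>w = 1\<close> later keeps rounding errors out
  of the middle of a long chain.\<close>

lemma fraction_subset:
  fixes p q :: "'a \<Rightarrow> real"
  assumes "finite Z" "\<And>g. g \<in> Z \<Longrightarrow> p g > 0" "\<And>g. g \<in> Z \<Longrightarrow> q g > 0"
    and small: "\<And>g. g \<in> Z \<Longrightarrow> p g \<le> e" and "e \<ge> 0" and w: "0 \<le> w" "w \<le> 1"
  shows "\<exists>S\<subseteq>Z. sum p S \<le> w * sum p Z + e \<and> w * sum q Z \<le> sum q S \<and>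
    (w = 0 \<longrightarrow> S = {}) \<and> (w = 1 \<longrightarrow> S = Z)"
proof -
  consider "w = 0" | "w = 1" | "w \<noteq> 0 \<and> w \<noteq> 1" by blast
  then show ?thesis
  proof cases
    case 1 then show ?thesis using \<open>e \<ge> 0\<close> by auto
  next
    case 2 then show ?thesis using \<open>e \<ge> 0\<close> by auto
  next
    case 3
    \<comment> \<open>The comparison of densities is cross-multiplied, so that it stays meaningful
      when a sum is zero.\<close>
    define A where "A = {S. S \<subseteq> Z \<and> w * sum p Z \<le> sum p S \<and> sum p S * sum q Z \<le> sum q S * sum p Z}"
    have pZ: "sum p Z \<ge> 0" and qZ: "sum q Z \<ge> 0" using assms by (simp_all add: sum_nonneg less_imp_le)
    have "Z \<in> A" using w pZ by (auto simp: A_def mult_left_le_one_le mult.commute)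
    then obtain S where S: "S \<in> A" and least: "\<And>S'. S' \<in> A \<Longrightarrow> card S \<le> card S'"
      using arg_min_nat_lemma[of "\<lambda>S. S \<in> A" Z card] by blast
    have SZ: "S \<subseteq> Z" and Sw: "w * sum p Z \<le> sum p S" and Sr: "sum p S * sum q Z \<le> sum q S * sum p Z"
      using S by (auto simp: A_def)
    have fS: "finite S" using SZ assms(1) finite_subset by blast
    have le: "sum p S \<le> w * sum p Z + e"
    proof (rule ccontr)
      assume big: "\<not> ?thesis"
      have pS: "sum p S > 0" using big \<open>e \<ge> 0\<close> w pZ by (smt (verit) mult_nonneg_nonneg)
      then have "S \<noteq> {}" by auto
      \<comment> \<open>If every item were denser than the average, summing over \<open>S\<close>
        would make \<open>sum p S * sum q S\<close> smaller than itself.\<close>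
      have "\<exists>g\<in>S. q g * sum p S \<le> p g * sum q S"
      proof (rule ccontr)
        assume "\<not> ?thesis"
        then have "(\<Sum>g\<in>S. p g * sum q S) < (\<Sum>g\<in>S. q g * sum p S)"
          using fS \<open>S \<noteq> {}\<close> by (intro sum_strict_mono) auto
        then show False by (simp add: sum_distrib_right[symmetric] mult.commute)
      qed
      then obtain g where g: "g \<in> S" "q g * sum p S \<le> p g * sum q S" by blast
      have s: "sum p (S - {g}) = sum p S - p g" "sum q (S - {g}) = sum q S - q g"
        using g fS by (auto simp: sum_diff1)
      have "w * sum p Z \<le> sum p (S - {g})"
        using big small[of g] g SZ s by auto
      moreover have "sum p (S - {g}) * sum q Z \<le> sum q (S - {g}) * sum p Z"
      proof -
        have "sum p (S - {g}) * sum q S \<le> sum q (S - {g}) * sum p S"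
          unfolding s using g(2) by (simp add: algebra_simps)
        then have "sum p (S - {g}) * (sum p S * sum q Z) \<le> sum q (S - {g}) * (sum p S * sum p Z)"
        proof -
          have "sum p (S - {g}) \<ge> 0" using assms(2) SZ by (intro sum_nonneg) (auto intro: less_imp_le)
          then have "sum p (S - {g}) * (sum p S * sum q Z) \<le> sum p (S - {g}) * (sum q S * sum p Z)"
            using Sr by (rule mult_left_mono[rotated])
          also have "\<dots> = (sum p (S - {g}) * sum q S) * sum p Z" by simp
          also have "\<dots> \<le> (sum q (S - {g}) * sum p S) * sum p Z"
            using \<open>sum p (S - {g}) * sum q S \<le> sum q (S - {g}) * sum p S\<close> pZ by (rule mult_right_mono)
          finally show ?thesis by (simp add: mult.assoc)
        qed
        then have "sum p S * (sum p (S - {g}) * sum q Z) \<le> sum p S * (sum q (S - {g}) * sum p Z)"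
          by (simp add: ac_simps)
        then show ?thesis using pS by simp
      qed
      ultimately have "S - {g} \<in> A" using SZ by (auto simp: A_def)
      then have "card S \<le> card (S - {g})" by (rule least)
      then show False using g fS by (meson card_Diff1_less not_le)
    qed
    have "w * sum q Z \<le> sum q S"
    proof (cases "Z = {}")
      case False
      then have "sum p Z > 0" using assms by (intro sum_pos) auto
      have "(w * sum q Z) * sum p Z \<le> sum p S * sum q Z"
        using mult_right_mono[OF Sw qZ] by (simp add: ac_simps)
      also have "\<dots> \<le> sum q S * sum p Z" by (rule Sr)
      finally show ?thesis using \<open>sum p Z > 0\<close> by simp
    qed (use SZ in auto)
    then show ?thesis using le SZ 3 by blast
  qed
qed

text \<open>If the orbit leaves \<open>T\<close>, a repetition could be pushed forward to the exit
  time, where a point of \<open>T\<close> would equal the exit point. If it stays, the pigeonhole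
  principle gives a repetition, and injectivity cancels the common initial steps, so the orbit
  returns to \<open>j\<close> itself.\<close>

lemma orbit_exits_or_cycles:
  assumes "finite T" "inj_on f T" "j \<in> T" "f j \<noteq> j"
  obtains m where "m \<ge> 1" "inj_on (\<lambda>t. (f ^^ t) j) {..m}" "\<And>t. t < m \<Longrightarrow> (f ^^ t) j \<in> T"
      "(f ^^ m) j \<notin> T"
    | m where "m \<ge> 1" "inj_on (\<lambda>t. (f ^^ t) j) {..m}" "\<And>t. t \<le> m \<Longrightarrow> (f ^^ t) j \<in> T"
      "(f ^^ Suc m) j = j"
proof (cases "\<exists>t. (f ^^ t) j \<notin> T")
  case True
  define m where "m = (LEAST t. (f ^^ t) j \<notin> T)"
  have out: "(f ^^ m) j \<notin> T" unfolding m_def using True by (rule LeastI_ex)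
  have inT: "(f ^^ t) j \<in> T" if "t < m" for t using not_less_Least that unfolding m_def by blast
  have "m \<ge> 1" using out \<open>j \<in> T\<close> by (cases m) auto
  moreover have "inj_on (\<lambda>t. (f ^^ t) j) {..m}"
  proof (rule linorder_inj_onI')
    fix a b assume ab: "a \<in> {..m}" "b \<in> {..m}" "a < b"
    show "(f ^^ a) j \<noteq> (f ^^ b) j"
    proof
      assume "(f ^^ a) j = (f ^^ b) j"
      then have "(f ^^ (m - b + a)) j = (f ^^ (m - b + b)) j" by (simp only: funpow_add o_apply)
      moreover have "m - b + a < m" "m - b + b = m" using ab by auto
      ultimately show False using inT[of "m - b + a"] out by simp
    qed
  qed
  ultimately show thesis using that(1) inT out by blast
next
  case False
  then have inT: "(f ^^ t) j \<in> T" for t by blast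
  have "\<not> inj (\<lambda>t. (f ^^ t) j)"
    using inT \<open>finite T\<close> by (metis finite_imageD finite_subset image_subsetI infinite_UNIV_nat)
  then obtain a b where ab: "a < b" "(f ^^ a) j = (f ^^ b) j"
    using linorder_injI[of "\<lambda>t. (f ^^ t) j"] by blast
  have "(f ^^ a) j = (f ^^ (a + d)) j \<Longrightarrow> (f ^^ d) j = j" for a d
  proof (induction a)
    case (Suc a)
    then have "f ((f ^^ a) j) = f ((f ^^ (a + d)) j)" by simp
    then have "(f ^^ a) j = (f ^^ (a + d)) j" using \<open>inj_on f T\<close> inT by (meson inj_onD)
    then show ?case by (rule Suc.IH)
  qed simp
  from this[of a "b - a"] ab have ex: "\<exists>k. k > 0 \<and> (f ^^ k) j = j" by (intro exI[of _ "b - a"]) auto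
  define k where "k = (LEAST k. k > 0 \<and> (f ^^ k) j = j)"
  have k: "k > 0" "(f ^^ k) j = j" using LeastI_ex[OF ex] unfolding k_def by auto
  have least: "\<not> (c > 0 \<and> (f ^^ c) j = j)" if "c < k" for c
    using not_less_Least that unfolding k_def by blast
  \<comment> \<open>A return time of 1 would be a fixed point, so the cycle has at least two
    elements.\<close>
  have "k \<noteq> 1" using k \<open>f j \<noteq> j\<close> by auto
  then have "k - 1 \<ge> 1" using k by simp
  moreover have "inj_on (\<lambda>t. (f ^^ t) j) {..k - 1}"
  proof (rule linorder_inj_onI')
    fix a b assume ab: "a \<in> {..k - 1}" "b \<in> {..k - 1}" "a < b"
    show "(f ^^ a) j \<noteq> (f ^^ b) j"
    proof
      assume "(f ^^ a) j = (f ^^ b) j"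
      then have "(f ^^ (k - b + a)) j = (f ^^ (k - b + b)) j" by (simp only: funpow_add o_apply)
      moreover have "k - b + a < k" "k - b + b = k" "k - b + a > 0" using ab k(1) by auto
      ultimately show False using least[of "k - b + a"] k by simp
    qed
  qed
  ultimately show thesis using that(2)[of "k - 1"] inT k by simp
qed

text \<open>Here \<open>s\<close> is \<open>sqrt \<epsilon>\<close>, \<open>p\<close> is the kept
  share at the start of a chain, and \<open>a\<close> and \<open>b\<close> are those of two agents
  at equal distance from its two ends. In units of \<open>1 / L\<close>, the gain
  \<open>b - a\<close> competes with the product term \<open>a * b / L\<close> and the rounding
  error \<open>2 * L * s^2\<close>. With \<open>L\<close> of order \<open>1 / s\<close> both are of
  order \<open>s\<close>, and the constant 8 makes the gap between \<open>p\<close> and 1 exceed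
  them.\<close>

lemma ramp_factors:
  fixes s p a b L :: real
  assumes s: "0 < s" "s < 1/8" and L: "1 / (2 * s) \<le> L" "L \<le> 5 / (8 * s)"
    and p: "0 \<le> p" "p < 1 / (1 + 8 * s)"
    and a: "0 \<le> a" "(1 - L * s\<^sup>2) * a \<le> p" and b: "1 - L * s\<^sup>2 \<le> b"
  shows "0 < 1 - a / L - s\<^sup>2" "1 < (1 - a / L - s\<^sup>2) * (1 + b / L - s\<^sup>2)"
proof -
  define c where "c = 1 / L"
  define x where "x = L * s\<^sup>2"
  define y where "y = 1 - x"
  have "0 < 1 / (2 * s)" using s by simp
  then have "L > 0" using L by linarith
  have c: "0 < c" "c \<le> 2 * s" using L s \<open>L > 0\<close> by (auto simp: c_def field_simps)
  have "8 * (L * s) \<le> 5" using L s by (simp add: field_simps)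
  then have "8 * (L * s) * s \<le> 5 * s" using s by (intro mult_right_mono) auto
  then have x: "0 < x" "8 * x \<le> 5 * s" using \<open>L > 0\<close> s by (auto simp: x_def power2_eq_square)
  have xc: "x * c = s\<^sup>2" using \<open>L > 0\<close> by (simp add: x_def c_def)
  have s2: "s\<^sup>2 < 1 / 64" using s power_strict_mono[of s "1/8" 2] by (simp add: power2_eq_square)
  have s20: "s\<^sup>2 > 0" using s by simp
  have y: "9 / 10 < y" "y < 1" using x s by (auto simp: y_def)
  have p1: "p * (1 + 8 * s) < 1" using p s by (simp add: field_simps)
  have ay: "y * a \<le> p" using a by (simp add: y_def x_def)
  have "p * s \<ge> 0" using p s by simp
  then have "p < 1" using p1 by (simp add: distrib_left)
  have a2: "a < 10 / 9"
  proof -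
    have "9 / 10 * a \<le> y * a" using y a by (intro mult_right_mono) auto
    then show ?thesis using ay \<open>p < 1\<close> by simp
  qed
  have ac: "a * c \<le> 10 / 9 * (1 / 4)" using a2 c a s by (intro mult_mono) auto
  show pos: "0 < 1 - a / L - s\<^sup>2" using ac s2 by (simp add: c_def)
  \<comment> \<open>The next inequality times \<open>1 + 8 * s\<close>, with
    \<open>p * (1 + 8 * s)\<close> replaced by its bound 1 and a factor \<open>s\<close>
    cancelled.\<close>
  have key: "13 / 4 + 10 * s < (1 - s\<^sup>2) * (27 / 4 - 10 * s)"
  proof -
    have "63 / 64 * (27 / 4 - 10 * s) \<le> (1 - s\<^sup>2) * (27 / 4 - 10 * s)"
      using s2 s by (intro mult_right_mono) auto
    then show ?thesis using s by simp
  qed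
  have "5 / 4 * s + 2 * s * p < (1 - s\<^sup>2) * (1 - 5 / 4 * s - p)"
  proof -
    have "(5 / 4 * s + 2 * s * p) * (1 + 8 * s) = 5/4 * s * (1 + 8 * s) + 2 * s * (p * (1 + 8 * s))"
      by (simp add: algebra_simps)
    also have "\<dots> \<le> 5/4 * s * (1 + 8 * s) + 2 * s * 1"
      using p1 s by (intro add_left_mono mult_left_mono) auto
    also have "\<dots> = s * (13 / 4 + 10 * s)" by (simp add: field_simps)
    also have "\<dots> < s * ((1 - s\<^sup>2) * (27 / 4 - 10 * s))" using key s by simp
    also have "\<dots> = (1 - s\<^sup>2) * ((1 - 5 / 4 * s) * (1 + 8 * s) - 1)" by (simp add: field_simps)
    also have "\<dots> \<le> (1 - s\<^sup>2) * ((1 - 5 / 4 * s) * (1 + 8 * s) - p * (1 + 8 * s))"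
      using p1 s2 by (intro mult_left_mono) auto
    also have "\<dots> = (1 - s\<^sup>2) * (1 - 5 / 4 * s - p) * (1 + 8 * s)" by (simp add: algebra_simps)
    finally show ?thesis using s by simp
  qed
  also have "\<dots> \<le> (1 - s\<^sup>2) * (y\<^sup>2 - p)"
  proof (rule mult_left_mono)
    have "y\<^sup>2 = 1 - 2 * x + x\<^sup>2" by (simp add: y_def power2_eq_square algebra_simps)
    then show "1 - 5 / 4 * s - p \<le> y\<^sup>2 - p" using x zero_le_power2[of x] by linarith
  qed (use s2 in auto)
  \<comment> \<open>Only the product \<open>y * a\<close> is bounded by \<open>p\<close>, so the
    estimate is first proved with an extra factor \<open>y\<close>, which is cancelled
    below.\<close>
  also have "\<dots> \<le> (1 - s\<^sup>2) * (y * y - y * a)"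
    using ay s2 by (intro mult_left_mono) (auto simp: power2_eq_square)
  also have "\<dots> = y * ((1 - s\<^sup>2) * (y - a))" by (simp add: algebra_simps)
  finally have 1: "5 / 4 * s + 2 * s * p < y * ((1 - s\<^sup>2) * (y - a))" .
  have "y * (2 * x + y * a * c) \<le> 2 * x + y * a * c"
    using y x a c by (intro mult_left_le_one_le) auto
  also have "\<dots> \<le> 2 * x + p * (2 * s)"
    using ay c p by (intro add_left_mono mult_mono) auto
  also have "\<dots> \<le> 5 / 4 * s + 2 * s * p" using x by simp
  also note 1
  finally have "y * (2 * x + y * a * c) < y * ((1 - s\<^sup>2) * (y - a))" .
  then have 2: "2 * x + y * a * c < (1 - s\<^sup>2) * (y - a)" using y by simp
  have "(1 - a * c - s\<^sup>2) * (1 + y * c - s\<^sup>2) - 1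
      = c * ((1 - s\<^sup>2) * (y - a) - y * a * c) - 2 * s\<^sup>2 + s\<^sup>2 * s\<^sup>2" by (simp add: algebra_simps)
  \<comment> \<open>Since \<open>x * c = s^2\<close>, the rounding loss is also a multiple of
    \<open>c\<close>, and only the sign of the bracket matters.\<close>
  also have "\<dots> = c * ((1 - s\<^sup>2) * (y - a) - y * a * c - 2 * x) + s\<^sup>2 * s\<^sup>2"
    by (simp add: algebra_simps xc[symmetric])
  also have "\<dots> > 0" using 2 c by (intro add_pos_nonneg mult_pos_pos) auto
  finally have "1 < (1 - a * c - s\<^sup>2) * (1 + y * c - s\<^sup>2)" by simp
  also have "\<dots> \<le> (1 - a * c - s\<^sup>2) * (1 + b * c - s\<^sup>2)"
    using pos b c by (intro mult_left_mono) (auto simp: y_def x_def c_def divide_right_mono)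
  finally show "1 < (1 - a / L - s\<^sup>2) * (1 + b / L - s\<^sup>2)" by (simp add: c_def)
qed

section \<open>Invariants of the algorithm\<close>

locale market =
  fixes n :: nat and v :: "'a valuations" and \<M> :: "'a set" and X :: "'a bundles"
  assumes finite_items: "finite \<M>"
    and v_pos: "\<And>i g. i \<in> {1..n} \<Longrightarrow> g \<in> \<M> \<Longrightarrow> v i g > 0"
    and allocation_X: "allocation n \<M> X"
begin

lemma X_subset: "i \<in> {1..n} \<Longrightarrow> X i \<subseteq> \<M>"
  using allocation_X by (auto simp: allocation_def)

lemma X_eq: "g \<in> X i \<Longrightarrow> g \<in> X j \<Longrightarrow> i \<in> {1..n} \<Longrightarrow> j \<in> {1..n} \<Longrightarrow> i = j"
  using allocation_X unfolding allocation_def disjoint_family_on_def by blast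

lemma v_nonneg: "i \<in> {1..n} \<Longrightarrow> g \<in> \<M> \<Longrightarrow> 0 \<le> v i g"
  using v_pos by (blast intro: less_imp_le)

lemma bundle_value_nonneg: "i \<in> {1..n} \<Longrightarrow> S \<subseteq> \<M> \<Longrightarrow> bundle_value v i S \<ge> 0"
  unfolding bundle_value_def by (intro sum_nonneg v_nonneg) auto

lemma bundle_value_mono:
  "i \<in> {1..n} \<Longrightarrow> S \<subseteq> S' \<Longrightarrow> S' \<subseteq> \<M> \<Longrightarrow> bundle_value v i S \<le> bundle_value v i S'"
  unfolding bundle_value_def using finite_items
  by (intro sum_mono2 v_nonneg) (auto intro: finite_subset)

lemma robust_value_ge:
  assumes "S \<subseteq> \<M>" "g \<in> S"
  shows "bundle_value v i (S - {g}) \<le> robust_value v i S"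
  using assms finite_subset[OF assms(1) finite_items] by (auto simp: robust_value_def)

lemma robust_value_le:
  assumes "S \<subseteq> \<M>" "c \<ge> 0" "\<And>g. g \<in> S \<Longrightarrow> bundle_value v i (S - {g}) \<le> c"
  shows "robust_value v i S \<le> c"
  using assms finite_subset[OF assms(1) finite_items] by (auto simp: robust_value_def)

lemma robust_value_nonneg: "i \<in> {1..n} \<Longrightarrow> S \<subseteq> \<M> \<Longrightarrow> robust_value v i S \<ge> 0"
  by (cases "S = {}")
    (auto simp: robust_value_def[of _ _ "{}"]
      intro: order_trans[OF bundle_value_nonneg robust_value_ge])

lemma robust_value_mono:
  assumes "i \<in> {1..n}" "S \<subseteq> S'" "S' \<subseteq> \<M>"
  shows "robust_value v i S \<le> robust_value v i S'"
proof (rule robust_value_le)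
  show "bundle_value v i (S - {g}) \<le> robust_value v i S'" if "g \<in> S" for g
    using that assms bundle_value_mono[of i "S - {g}" "S' - {g}"] robust_value_ge[of S' g i] by force
qed (use assms robust_value_nonneg in auto)

text \<open>Removing a least valuable item leaves the most, so the removal made by the algorithm
  attains the robust value exactly.\<close>

lemma robust_value_remove_min:
  assumes "S \<subseteq> \<M>" "i \<in> {1..n}" "is_arg_min (v i) (\<lambda>g. g \<in> S) g"
  shows "robust_value v i S = bundle_value v i (S - {g})"
proof (rule antisym)
  have fin: "finite S" using assms(1) finite_items by (rule finite_subset)
  have g: "g \<in> S" and le: "\<And>h. h \<in> S \<Longrightarrow> v i g \<le> v i h"
    using assms(3) by (auto simp: is_arg_min_linorder)
  show "bundle_value v i (S - {g}) \<le> robust_value v i S" using assms g by (intro robust_value_ge)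
  show "robust_value v i S \<le> bundle_value v i (S - {g})"
    using assms(1,2) le g fin
    by (intro robust_value_le bundle_value_nonneg) (auto simp: bundle_value_def sum_diff1)
qed

section \<open>Choosing and updating matchings\<close>

text \<open>The existential clause is what makes criterion (a) satisfiable in the next
  iteration.\<close>

definition valid_state :: "'a bundles \<Rightarrow> nat set \<Rightarrow> bool" where
  "valid_state Z T \<longleftrightarrow> (\<forall>k\<in>{1..n}. Z k \<subseteq> X k) \<and> T \<subseteq> {1..n} \<and> (\<forall>k\<in>{1..n} - T. Z k = X k) \<and>
    (\<exists>M. covering_matching n v Z T M)"

lemma valid_state_subset: "valid_state Z T \<Longrightarrow> k \<in> {1..n} \<Longrightarrow> Z k \<subseteq> \<M>"
  unfolding valid_state_def using X_subset by blast

lemma valid_state_initial: "valid_state X {}"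
  by (auto simp: valid_state_def covering_matching_def matching_def)

lemma finite_matching: "matching (feasibility_graph n v Z) M \<Longrightarrow> finite M"
  unfolding matching_def feasibility_graph_def
  by (rule finite_subset[of _ "{1..n} \<times> {1..n}"]) auto

lemma selectable_matchingD:
  assumes "selectable_matching n v Z T M"
  shows "covering_matching n v Z T M"
    "covering_matching n v Z T M' \<Longrightarrow> card (M' \<inter> Id) \<le> card (M \<inter> Id)"
  using assms by (auto simp: selectable_matching_def is_arg_max_linorder)

text \<open>A matching has at most \<open>n * n\<close> edges, so both of the nested maxima are
  attained.\<close>

lemma selectable_matching_exists:
  assumes "valid_state Z T"
  shows "\<exists>M. selectable_matching n v Z T M"
proof -
  have bound: "card (M \<inter> Id) < Suc (n * n)" "card M < Suc (n * n)" if "covering_matching n v Z T M" for M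
  proof -
    have "M \<subseteq> {1..n} \<times> {1..n}"
      using that by (auto simp: covering_matching_def matching_def feasibility_graph_def)
    then show "card M < Suc (n * n)" "card (M \<inter> Id) < Suc (n * n)"
      using card_mono[of "{1..n} \<times> {1..n}" M] card_mono[of "{1..n} \<times> {1..n}" "M \<inter> Id"] by force+
  qed
  obtain M0 where M0: "covering_matching n v Z T M0" using assms by (auto simp: valid_state_def)
  let ?P = "is_arg_max (\<lambda>M. card (M \<inter> Id)) (covering_matching n v Z T)"
  have "\<exists>M1. ?P M1"
    using ex_has_greatest_nat[of "covering_matching n v Z T" M0 "\<lambda>M. card (M \<inter> Id)" "Suc (n * n)"] M0 bound(1)
    by (auto simp: is_arg_max_linorder)
  then obtain M1 where M1: "?P M1" by blast
  have "card M < Suc (n * n)" if "?P M" for M using that bound(2) by (simp add: is_arg_max_def)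
  then show ?thesis
    using ex_has_greatest_nat[of ?P M1 card "Suc (n * n)"] M1
    by (auto simp: selectable_matching_def is_arg_max_linorder)
qed

text \<open>Dropping the edge at \<open>j\<close> frees this bundle, and \<open>i\<close> is free
  already. It is applied with \<open>j = i\<close> in an unchanged graph, and to the demanded bundle
  after an item has been removed.\<close>

lemma covering_matching_rematch:
  assumes "covering_matching n v Z T M" "i \<notin> fst ` M" "(i, j) \<in> feasibility_graph n v Z'"
    and "\<And>e. e \<in> M \<Longrightarrow> snd e \<noteq> j \<Longrightarrow> e \<in> feasibility_graph n v Z'"
  shows "covering_matching n v Z' (insert j T) (insert (i, j) {e \<in> M. snd e \<noteq> j})"
proof -
  let ?N = "{e \<in> M. snd e \<noteq> j}"
  have inj: "inj_on fst ?N" "inj_on snd ?N"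
    using assms(1) by (auto simp: covering_matching_def matching_def intro: inj_on_subset)
  have "i \<notin> fst ` (?N - {(i, j)})" "j \<notin> snd ` (?N - {(i, j)})" using assms(2) by blast+
  then have "matching (feasibility_graph n v Z') (insert (i, j) ?N)"
    using inj assms(3,4) unfolding matching_def by (auto simp only: inj_on_insert fst_conv snd_conv)
  moreover have "insert j T \<subseteq> snd ` insert (i, j) ?N"
    using assms(1) by (auto simp: covering_matching_def)
  ultimately show ?thesis by (simp add: covering_matching_def)
qed

lemma unmatched_agent_not_self_feasible:
  assumes "selectable_matching n v Z T M" "i \<notin> fst ` M"
  shows "(i, i) \<notin> feasibility_graph n v Z"
proof
  assume G: "(i, i) \<in> feasibility_graph n v Z"
  let ?M = "insert (i, i) {e \<in> M. snd e \<noteq> i}"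
  have cov: "covering_matching n v Z T M" by (rule selectable_matchingD(1)[OF assms(1)])
  then have fin: "finite M" by (auto simp: covering_matching_def finite_matching)
  have "covering_matching n v Z (insert i T) ?M"
    using cov by (intro covering_matching_rematch[OF cov assms(2) G])
      (auto simp: covering_matching_def matching_def)
  then have "covering_matching n v Z T ?M" by (simp add: covering_matching_def)
  then have le: "card (?M \<inter> Id) \<le> card (M \<inter> Id)" by (rule selectable_matchingD(2)[OF assms(1)])
  \<comment> \<open>An evicted edge ends at \<open>i\<close> but cannot start there, because
    \<open>i\<close> is unmatched; hence no diagonal edge is lost.\<close>
  have "?M \<inter> Id = insert (i, i) (M \<inter> Id)" using assms(2) by force
  moreover have "(i, i) \<notin> M \<inter> Id" using assms(2) by force
  ultimately show False using le fin by simp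
qed

text \<open>The shrunken bundle is worth to \<open>i\<close> exactly the largest robust value before
  the removal, so it is feasible for \<open>i\<close>. Edges to other bundles survive, since a
  removal only lowers robust values and the values of the agents' own bundles.\<close>

lemma remove_item_matching:
  fixes Z T i j g
  defines "Z' \<equiv> Z(j := Z j - {g})"
  assumes valid: "valid_state Z T" and sel: "selectable_matching n v Z T M"
    and i: "i \<in> {1..n}" "i \<notin> fst ` M" and demand: "robust_demand n v Z i j"
    and g: "is_arg_min (v i) (\<lambda>g. g \<in> Z j) g"
  shows "\<exists>M'. covering_matching n v Z' (insert j T) M' \<and> (i, j) \<in> M' \<and> i \<noteq> j"
proof -
  have ZM: "Z k \<subseteq> \<M>" if "k \<in> {1..n}" for k
    using valid that by (rule valid_state_subset)
  have j: "j \<in> {1..n}" and max: "\<And>k. k \<in> {1..n} \<Longrightarrow> robust_value v i (Z k) \<le> robust_value v i (Z j)"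
    using demand by (auto simp: robust_demand_def is_arg_max_linorder)
  have Z'Z: "Z' k \<subseteq> Z k" for k by (auto simp: Z'_def)
  have Z'M: "Z' k \<subseteq> \<M>" if "k \<in> {1..n}" for k using ZM[OF that] Z'Z by blast
  have rob: "robust_value v i (Z j) = bundle_value v i (Z' j)"
    using robust_value_remove_min[OF ZM[OF j] i(1) g] by (simp add: Z'_def)
  have less: "bundle_value v i (Z i) < bundle_value v i (Z' j)"
  \<comment> \<open>Otherwise \<open>Z i\<close> would be worth at least every robust value, hence
    be feasible for its own agent.\<close>
  proof (rule ccontr)
    assume "\<not> ?thesis"
    then have "(i, i) \<in> feasibility_graph n v Z"
      using i rob max by (force simp: feasibility_graph_def EFX_feasible_def)
    then show False using unmatched_agent_not_self_feasible[OF sel i(2)] by blast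
  qed
  have ij: "i \<noteq> j"
    using less bundle_value_mono[OF i(1) Z'Z ZM[OF i(1)]] by auto
  have Z'i: "Z' i = Z i" using ij by (simp add: Z'_def)
  have mono: "robust_value v a (Z' k) \<le> robust_value v a (Z k)" if "a \<in> {1..n}" "k \<in> {1..n}" for a k
    using that by (intro robust_value_mono Z'Z ZM)
  have new: "(i, j) \<in> feasibility_graph n v Z'"
    using i(1) j less Z'i mono[OF i(1)] max rob
    by (force simp: feasibility_graph_def EFX_feasible_def)
  have old: "(a, k) \<in> feasibility_graph n v Z'" if "(a, k) \<in> feasibility_graph n v Z" "k \<noteq> j" for a k
  proof -
    have ak: "a \<in> {1..n}" "k \<in> {1..n}" using that by (auto simp: feasibility_graph_def)
    have "Z' k = Z k" using that(2) by (simp add: Z'_def)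
    then show ?thesis
      using that(1) ak mono[OF ak(1)] bundle_value_mono[OF ak(1) Z'Z[of a] ZM[OF ak(1)]]
      by (force simp: feasibility_graph_def EFX_feasible_def)
  qed
  have cov: "covering_matching n v Z T M" by (rule selectable_matchingD(1)[OF sel])
  then have "e \<in> feasibility_graph n v Z'" if "e \<in> M" "snd e \<noteq> j" for e
    using old[of "fst e" "snd e"] that by (auto simp: covering_matching_def matching_def)
  then have "covering_matching n v Z' (insert j T) (insert (i, j) {e \<in> M. snd e \<noteq> j})"
    by (rule covering_matching_rematch[OF cov i(2) new])
  then show ?thesis using ij by blast
qed

end

section \<open>Exchanges in an optimal allocation\<close>

locale optimal_market = market +
  assumes agents: "n \<ge> 1"
    and optimal: "NW n v X = opt_NW n v \<M>"
    and NW_pos: "NW n v X > 0"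
begin

text \<open>Values are scaled so that each bundle of \<open>X\<close> has value 1 for its owner; an
  exchange then multiplies the Nash product by a product of shares.\<close>

definition share :: "nat \<Rightarrow> 'a set \<Rightarrow> real" where
  "share b S = bundle_value v b S / bundle_value v b (X b)"

lemma bundle_value_X_pos:
  assumes "b \<in> {1..n}" shows "bundle_value v b (X b) > 0"
proof -
  have "(\<Prod>i\<in>{1..n}. bundle_value v i (X i)) \<noteq> 0" using NW_pos by (auto simp: NW_def)
  then have "bundle_value v b (X b) \<noteq> 0" using assms by auto
  then show ?thesis using bundle_value_nonneg[OF assms X_subset[OF assms]] by simp
qed

lemma share_X: "b \<in> {1..n} \<Longrightarrow> share b (X b) = 1"
  using bundle_value_X_pos[of b] by (simp add: share_def)

lemma share_empty [simp]: "share b {} = 0"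
  by (simp add: share_def bundle_value_def)

lemma share_nonneg: "b \<in> {1..n} \<Longrightarrow> S \<subseteq> \<M> \<Longrightarrow> share b S \<ge> 0"
  using bundle_value_X_pos[of b] bundle_value_nonneg[of b S] by (simp add: share_def)

lemma share_mono: "b \<in> {1..n} \<Longrightarrow> S \<subseteq> S' \<Longrightarrow> S' \<subseteq> \<M> \<Longrightarrow> share b S \<le> share b S'"
  using bundle_value_X_pos[of b] bundle_value_mono[of b S S'] by (simp add: share_def divide_right_mono)

lemma share_le_1: "b \<in> {1..n} \<Longrightarrow> S \<subseteq> X b \<Longrightarrow> share b S \<le> 1"
  using share_mono[of b S "X b"] share_X[of b] X_subset[of b] by simp

lemma share_less_iff: "b \<in> {1..n} \<Longrightarrow> share b S < share b S' \<longleftrightarrow> bundle_value v b S < bundle_value v b S'"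
  using bundle_value_X_pos[of b] by (simp add: share_def divide_less_cancel)

lemma share_eq_sum: "share b S = (\<Sum>g\<in>S. share b {g})"
  by (simp add: share_def bundle_value_def sum_divide_distrib)

text \<open>Bundle families are functions on all of \<open>nat\<close>, so one allocation has
  infinitely many representatives. Restricting them to the agents leaves finitely many, as
  \<open>Max\<close> requires.\<close>

lemma finite_NW_image: "finite (NW n v ` {Y. allocation n \<M> Y})"
proof (rule finite_subset)
  show "NW n v ` {Y. allocation n \<M> Y} \<subseteq> NW n v ` ({1..n} \<rightarrow>\<^sub>E Pow \<M>)"
  proof (rule image_subsetI)
    fix Y :: "'a bundles" assume "Y \<in> {Y. allocation n \<M> Y}"
    then have "restrict Y {1..n} \<in> {1..n} \<rightarrow>\<^sub>E Pow \<M>" by (auto simp: allocation_def)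
    moreover have "NW n v Y = NW n v (restrict Y {1..n})" by (simp add: NW_def)
    ultimately show "NW n v Y \<in> NW n v ` ({1..n} \<rightarrow>\<^sub>E Pow \<M>)" by blast
  qed
  show "finite (NW n v ` ({1..n} \<rightarrow>\<^sub>E Pow \<M>))"
    using finite_items by (intro finite_imageI finite_PiE) auto
qed

lemma prod_bundle_value_le:
  assumes "allocation n \<M> Y"
  shows "(\<Prod>i\<in>{1..n}. bundle_value v i (Y i)) \<le> (\<Prod>i\<in>{1..n}. bundle_value v i (X i))"
proof (rule ccontr)
  assume "\<not> ?thesis"
  moreover have "(\<Prod>i\<in>{1..n}. bundle_value v i (X i)) > 0"
    using bundle_value_X_pos by (intro prod_pos) auto
  ultimately have "NW n v X < NW n v Y"
    unfolding NW_def using agents by (intro powr_less_mono2) auto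
  moreover have "NW n v Y \<le> opt_NW n v \<M>"
    unfolding opt_NW_def using assms finite_NW_image by (intro Max_ge) auto
  ultimately show False using optimal by simp
qed

text \<open>Agent \<open>x\<close> hands over \<open>R x\<close> and receives
  \<open>R (\<pi> x)\<close>. The result is again an allocation of all items, and the product is the
  ratio of its Nash product to that of the optimal \<open>X\<close>.\<close>

lemma permuted_exchange:
  assumes bij: "bij_betw \<pi> {1..n} {1..n}" and R: "\<And>x. x \<in> {1..n} \<Longrightarrow> R x \<subseteq> X x"
  shows "(\<Prod>x\<in>{1..n}. 1 - share x (R x) + share x (R (\<pi> x))) \<le> 1"
proof -
  define Y where "Y x = (X x - R x) \<union> R (\<pi> x)" for x
  have \<pi>: "\<pi> x \<in> {1..n}" if "x \<in> {1..n}" for x using bij that by (rule bij_betw_apply)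
  have \<pi>_inj: "\<pi> x = \<pi> y \<Longrightarrow> x \<in> {1..n} \<Longrightarrow> y \<in> {1..n} \<Longrightarrow> x = y" for x y
    using bij by (meson bij_betw_def inj_onD)
  have RX: "g \<in> R x \<Longrightarrow> x \<in> {1..n} \<Longrightarrow> g \<in> X x" for g x using R by blast
  have "allocation n \<M> Y"
    unfolding allocation_def
  proof
    show "disjoint_family_on Y {1..n}"
      unfolding disjoint_family_on_def
    proof (intro ballI impI equals0I)
      fix x y g assume x: "x \<in> {1..n}" and y: "y \<in> {1..n}" and "x \<noteq> y" "g \<in> Y x \<inter> Y y"
      then show False
        unfolding Y_def using RX[OF _ \<pi>[OF x]] RX[OF _ \<pi>[OF y]] X_eq[of g] \<pi>[OF x] \<pi>[OF y] \<pi>_inj[of x y]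
        by (metis DiffE IntE UnE)
    qed
    show "(\<Union>x\<in>{1..n}. Y x) = \<M>"
    proof
      show "(\<Union>x\<in>{1..n}. Y x) \<subseteq> \<M>" unfolding Y_def using R \<pi> X_subset by blast
      show "\<M> \<subseteq> (\<Union>x\<in>{1..n}. Y x)"
      proof
        fix g assume "g \<in> \<M>"
        then obtain x where x: "x \<in> {1..n}" "g \<in> X x" using allocation_X by (auto simp: allocation_def)
        obtain y where "y \<in> {1..n}" "\<pi> y = x" using bij x(1) by (metis bij_betw_def imageE)
        then show "g \<in> (\<Union>x\<in>{1..n}. Y x)" using x by (cases "g \<in> R x") (auto simp: Y_def)
      qed
    qed
  qed
  then have le: "(\<Prod>x\<in>{1..n}. bundle_value v x (Y x)) \<le> (\<Prod>x\<in>{1..n}. bundle_value v x (X x))"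
    by (rule prod_bundle_value_le)
  have "bundle_value v x (Y x) / bundle_value v x (X x) = 1 - share x (R x) + share x (R (\<pi> x))"
    if x: "x \<in> {1..n}" for x
  proof -
    have fin: "finite (X x)" "finite (R (\<pi> x))" "finite (R x)"
      using finite_items X_subset R x \<pi> by (meson finite_subset)+
    have "(X x - R x) \<inter> R (\<pi> x) = {}" using RX X_eq x \<pi> by (metis DiffE disjoint_iff)
    then have "bundle_value v x (Y x)
        = bundle_value v x (X x) - bundle_value v x (R x) + bundle_value v x (R (\<pi> x))"
      using fin R[OF x] by (simp add: Y_def bundle_value_def sum.union_disjoint sum_diff)
    then show ?thesis using bundle_value_X_pos[OF x] by (simp add: share_def field_simps)
  qed
  then have "(\<Prod>x\<in>{1..n}. 1 - share x (R x) + share x (R (\<pi> x)))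
      = (\<Prod>x\<in>{1..n}. bundle_value v x (Y x)) / (\<Prod>x\<in>{1..n}. bundle_value v x (X x))"
    by (simp add: prod_dividef[symmetric])
  also have "\<dots> \<le> 1"
    using le bundle_value_X_pos by (subst divide_le_eq_1_pos) (auto intro!: prod_pos)
  finally show ?thesis .
qed

text \<open>The permutation rotates the agents \<open>b 0\<close>, ..., \<open>b m\<close> and fixes
  all others, who hand over nothing and contribute the factor 1.\<close>

lemma cyclic_exchange:
  fixes b :: "nat \<Rightarrow> nat"
  assumes inj: "inj_on b {..m}" and b: "\<And>t. t \<le> m \<Longrightarrow> b t \<in> {1..n}"
    and S: "\<And>t. t \<le> m \<Longrightarrow> S t \<subseteq> X (b t)"
  shows "(\<Prod>t\<le>m. 1 - share (b t) (S t) + share (b t) (S (if t = 0 then m else t - 1))) \<le> 1"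
proof -
  define A where "A = b ` {..m}"
  \<comment> \<open>The wrap-around at 0 closes the cycle: \<open>b 0\<close> receives from
    \<open>b m\<close>.\<close>
  define pre where "pre t = (if t = 0 then m else t - 1)" for t
  define idx where "idx = the_inv_into {..m} b"
  define R where "R x = (if x \<in> A then S (idx x) else {})" for x
  define \<pi> where "\<pi> x = (if x \<in> A then b (pre (idx x)) else x)" for x
  have idx: "idx (b t) = t" if "t \<le> m" for t using inj that by (simp add: idx_def the_inv_into_f_f)
  have pre: "pre t \<le> m" if "t \<le> m" for t using that by (auto simp: pre_def)
  have pre_inj: "pre t = pre u \<Longrightarrow> t \<le> m \<Longrightarrow> u \<le> m \<Longrightarrow> t = u" for t u
    by (auto simp: pre_def split: if_splits)
  have A: "A \<subseteq> {1..n}" using b by (auto simp: A_def)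
  have bA: "b t \<in> A" if "t \<le> m" for t using that by (auto simp: A_def)
  have \<pi>_range: "\<pi> x \<in> {1..n}" if "x \<in> {1..n}" for x
  proof (cases "x \<in> A")
    case True
    then obtain t where "t \<le> m" "x = b t" by (auto simp: A_def)
    then show ?thesis using True b[OF pre] by (simp add: \<pi>_def idx)
  qed (use that in \<open>simp add: \<pi>_def\<close>)
  have "inj_on \<pi> {1..n}"
  proof (rule inj_onI)
    fix x y assume eq: "\<pi> x = \<pi> y"
    show "x = y"
    proof (cases "x \<in> A \<and> y \<in> A")
      case True
      then obtain t u where t: "t \<le> m" "x = b t" and u: "u \<le> m" "y = b u" by (auto simp: A_def)
      then have "b (pre t) = b (pre u)" using eq bA by (simp add: \<pi>_def idx)
      then show ?thesis using inj t u pre pre_inj by (simp add: inj_on_eq_iff)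
    next
      case False
      have "\<pi> z \<in> A \<longleftrightarrow> z \<in> A" for z
        using bA[OF pre] by (cases "z \<in> A") (auto simp: \<pi>_def A_def idx)
      then show ?thesis using False eq by (metis \<pi>_def)
    qed
  qed
  moreover have "\<pi> ` {1..n} = {1..n}" using calculation \<pi>_range by (intro endo_inj_surj) auto
  ultimately have "bij_betw \<pi> {1..n} {1..n}" by (simp add: bij_betw_def)
  moreover have "R x \<subseteq> X x" for x
  proof (cases "x \<in> A")
    case True
    then obtain t where "t \<le> m" "x = b t" by (auto simp: A_def)
    then show ?thesis using True S by (simp add: R_def idx)
  qed (simp add: R_def)
  ultimately have "(\<Prod>x\<in>{1..n}. 1 - share x (R x) + share x (R (\<pi> x))) \<le> 1"
    by (rule permuted_exchange)
  also have "(\<Prod>x\<in>{1..n}. 1 - share x (R x) + share x (R (\<pi> x)))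
      = (\<Prod>x\<in>A. 1 - share x (R x) + share x (R (\<pi> x)))"
    using A by (intro prod.mono_neutral_right) (auto simp: R_def \<pi>_def)
  also have "\<dots> = (\<Prod>t\<le>m. 1 - share (b t) (R (b t)) + share (b t) (R (\<pi> (b t))))"
    unfolding A_def using inj by (simp add: prod.reindex)
  also have "\<dots> = (\<Prod>t\<le>m. 1 - share (b t) (S t) + share (b t) (S (pre t)))"
    using bA pre by (intro prod.cong) (auto simp: R_def \<pi>_def idx)
  finally show ?thesis by (simp add: pre_def)
qed

end

locale large_market = optimal_market +
  fixes \<epsilon> :: real
  assumes eps_pos: "\<epsilon> > 0"
    and small_items: "\<And>i g. i \<in> {1..n} \<Longrightarrow> g \<in> X i \<Longrightarrow> v i g \<le> \<epsilon> * bundle_value v i (X i)"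
begin

lemma share_item_le: "b \<in> {1..n} \<Longrightarrow> g \<in> X b \<Longrightarrow> share b {g} \<le> \<epsilon>"
  using small_items[of b g] bundle_value_X_pos[of b]
  by (simp add: share_def bundle_value_def divide_le_eq)

lemma share_item_pos: "b \<in> {1..n} \<Longrightarrow> g \<in> \<M> \<Longrightarrow> share b {g} > 0"
  using v_pos[of b g] bundle_value_X_pos[of b] by (simp add: share_def bundle_value_def)

text \<open>Handing a single item from \<open>j\<close> to \<open>i\<close> must not increase the
  Nash product, which bounds the share of \<open>i\<close> in terms of that of \<open>j\<close>;
  summing over the items of \<open>S\<close> keeps the factor.\<close>

lemma cross_share:
  assumes "\<epsilon> < 1" and ij: "i \<in> {1..n}" "j \<in> {1..n}" "i \<noteq> j" and S: "S \<subseteq> X j"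
  shows "(1 - \<epsilon>) * share i S \<le> share j S"
proof -
  have "(1 - \<epsilon>) * share i {g} \<le> share j {g}" if "g \<in> S" for g
  proof -
    have g: "g \<in> X j" "g \<in> \<M>" using that S X_subset[OF ij(2)] by auto
    \<comment> \<open>The cycle has the two agents \<open>b 0 = j\<close> and
      \<open>b 1 = i\<close>, and only \<open>j\<close> hands something over.\<close>
    have "(\<Prod>t\<le>1. 1 - share (if t = 0 then j else i) (if t = 0 then {g} else {})
        + share (if t = 0 then j else i) (if (if t = 0 then 1 else t - 1) = (0::nat) then {g} else {})) \<le> 1"
      by (rule cyclic_exchange) (use ij g in \<open>auto simp: inj_on_def\<close>)
    then have "(1 - share j {g}) * (1 + share i {g}) \<le> 1"
      by simp
    then have 1: "share i {g} * (1 - share j {g}) \<le> share j {g}" by (simp add: algebra_simps)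
    have "share i {g} * (1 - \<epsilon>) \<le> share i {g} * (1 - share j {g})"
      using share_item_le[OF ij(2) g(1)] share_item_pos[OF ij(1) g(2)] by (intro mult_left_mono) auto
    then show ?thesis using 1 by (simp add: mult.commute)
  qed
  then have "(\<Sum>g\<in>S. (1 - \<epsilon>) * share i {g}) \<le> (\<Sum>g\<in>S. share j {g})" by (rule sum_mono)
  then show ?thesis
    by (simp only: sum_distrib_left[symmetric] share_eq_sum[of i S, symmetric] share_eq_sum[of j S, symmetric])
qed

end

section \<open>Improvement chains\<close>

locale improvement_chain = large_market +
  fixes Z :: "'a bundles" and b :: "nat \<Rightarrow> nat" and m :: nat
  assumes m: "m \<ge> 1" and inj_b: "inj_on b {..m}" and b: "\<And>t. t \<le> m \<Longrightarrow> b t \<in> {1..n}"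
    and Z: "\<And>t. t \<le> m \<Longrightarrow> Z (b t) \<subseteq> X (b t)" and last: "Z (b m) = X (b m)"
    and improving: "\<And>t. t < m \<Longrightarrow>
      bundle_value v (b (Suc t)) (Z (b (Suc t))) < bundle_value v (b (Suc t)) (Z (b t))"
begin

definition kept :: "nat \<Rightarrow> real" where
  "kept t = share (b t) (Z (b t))"

lemma ZM: "t \<le> m \<Longrightarrow> Z (b t) \<subseteq> \<M>"
  using Z X_subset b by blast

lemma kept_bounds: "t \<le> m \<Longrightarrow> 0 \<le> kept t" "t \<le> m \<Longrightarrow> kept t \<le> 1" "kept m = 1"
  using share_nonneg[OF b ZM] share_le_1[OF b Z] share_X[OF b] last by (auto simp: kept_def)

lemma kept_less: "t < m \<Longrightarrow> kept (Suc t) < share (b (Suc t)) (Z (b t))"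
  using improving[of t] b[of "Suc t"] by (simp add: kept_def share_less_iff)

text \<open>When the last agent hands over nothing, the cyclic exchange is a shift along a path, and
  \<open>b 0\<close> receives nothing.\<close>

lemma chain_exchange:
  assumes "\<And>t. t \<le> m \<Longrightarrow> S t \<subseteq> Z (b t)" "S m = {}"
  shows "(\<Prod>t\<le>m. 1 - share (b t) (S t) + (if t = 0 then 0 else share (b t) (S (t - 1)))) \<le> 1"
proof -
  have "(\<Prod>t\<le>m. 1 - share (b t) (S t) + share (b t) (S (if t = 0 then m else t - 1))) \<le> 1"
    using inj_b b by (rule cyclic_exchange) (use assms Z in blast)+
  also have "(\<Prod>t\<le>m. 1 - share (b t) (S t) + share (b t) (S (if t = 0 then m else t - 1)))
      = (\<Prod>t\<le>m. 1 - share (b t) (S t) + (if t = 0 then 0 else share (b t) (S (t - 1))))"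
    using assms(2) by (intro prod.cong) auto
  finally show ?thesis .
qed

text \<open>Every agent but the last passes on its whole bundle. The first factor is
  \<open>1 - kept 0\<close>, the middle ones are at least 1, and the last agent keeps share 1 and
  gains more than 1 on top; hence \<open>2 * (1 - kept 0) \<le> 1\<close>.\<close>

lemma kept_0_ge_half: "1 / 2 \<le> kept 0"
proof -
  obtain k where k: "m = Suc k" using m by (cases m) auto
  define S where "S t = (if t < m then Z (b t) else {})" for t
  define F where "F t = 1 - share (b t) (S t) + (if t = 0 then 0 else share (b t) (S (t - 1)))" for t
  have "(\<Prod>t\<le>m. F t) \<le> 1" unfolding F_def by (rule chain_exchange) (auto simp: S_def)
  moreover have "(\<Prod>t\<le>m. F t) = (\<Prod>t<Suc k. F t) * F m" by (simp add: k lessThan_Suc_atMost)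
  then have "(\<Prod>t\<le>m. F t) = F 0 * ((\<Prod>t<k. F (Suc t)) * F m)"
    by (simp only: prod.lessThan_Suc_shift mult.assoc)
  moreover have "1 \<le> (\<Prod>t<k. F (Suc t))"
  proof (rule prod_ge_1)
    show "1 \<le> F (Suc t)" if "t \<in> {..<k}" for t
      using kept_less[of t] that by (auto simp: F_def S_def k kept_def)
  qed
  moreover have "F m \<ge> 2"
    using kept_less[of k] kept_bounds(3) by (auto simp: F_def S_def k)
  moreover have F0: "F 0 = 1 - kept 0" "F 0 \<ge> 0" using kept_bounds(2)[of 0] m by (auto simp: F_def S_def kept_def)
  moreover have "1 * 2 \<le> (\<Prod>t<k. F (Suc t)) * F m" using calculation by (intro mult_mono) auto
  ultimately have "F 0 * 2 \<le> 1"
    using mult_left_mono[of 2 "(\<Prod>t<k. F (Suc t)) * F m" "F 0"] by linarith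
  then show ?thesis using F0 by simp
qed

text \<open>Agent \<open>b (Suc t)\<close> prefers the bundle of \<open>b t\<close> to its own, and
  by \<open>cross_share\<close> that bundle is worth almost as large a share to its owner.\<close>

lemma kept_drop:
  assumes "\<epsilon> < 1" "t < m" shows "(1 - \<epsilon>) * kept (Suc t) \<le> kept t"
proof -
  have "b (Suc t) \<noteq> b t" using inj_b assms by (auto dest!: inj_onD)
  then have "(1 - \<epsilon>) * share (b (Suc t)) (Z (b t)) \<le> kept t"
    unfolding kept_def using assms b Z by (intro cross_share) auto
  moreover have "(1 - \<epsilon>) * kept (Suc t) \<le> (1 - \<epsilon>) * share (b (Suc t)) (Z (b t))"
    using kept_less[OF assms(2)] assms(1) by (intro mult_left_mono) auto
  ultimately show ?thesis by simp
qed

lemma kept_power: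
  assumes "\<epsilon> < 1" "t + u \<le> m" shows "(1 - \<epsilon>) ^ u * kept (t + u) \<le> kept t"
  using assms(2)
proof (induction u)
  case (Suc u)
  have "(1 - \<epsilon>) ^ u * ((1 - \<epsilon>) * kept (Suc (t + u))) \<le> (1 - \<epsilon>) ^ u * kept (t + u)"
    using kept_drop[of "t + u"] Suc assms(1) by (intro mult_left_mono) auto
  then show ?case using Suc by (simp add: mult.assoc mult.left_commute)
qed simp

text \<open>Bernoulli's inequality makes the geometric bound linear, uniformly for all distances up
  to \<open>K\<close>.\<close>

lemma kept_linear:
  assumes "\<epsilon> < 1" "t + u \<le> m" "u \<le> K"
  shows "(1 - real K * \<epsilon>) * kept (t + u) \<le> kept t"
proof -
  have "1 + real u * (- \<epsilon>) \<le> (1 + (- \<epsilon>)) ^ u" using assms(1) by (intro Bernoulli_inequality) auto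
  moreover have "real u * \<epsilon> \<le> real K * \<epsilon>" using assms(3) eps_pos by (intro mult_right_mono) auto
  ultimately have "1 - real K * \<epsilon> \<le> (1 - \<epsilon>) ^ u" by simp
  then have "(1 - real K * \<epsilon>) * kept (t + u) \<le> (1 - \<epsilon>) ^ u * kept (t + u)"
    using kept_bounds assms(2) by (intro mult_right_mono) auto
  then show ?thesis using kept_power[OF assms(1,2)] by simp
qed

text \<open>\<open>fraction_subset\<close> with the owner's shares as weight and those of the next
  agent as gain: the rounding error falls on the owner only.\<close>

lemma fraction_of_bundle:
  assumes "t < m" "0 \<le> w" "w \<le> 1"
  shows "\<exists>S\<subseteq>Z (b t). share (b t) S \<le> w * kept t + \<epsilon> \<and> w * share (b (Suc t)) (Z (b t)) \<le> share (b (Suc t)) S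
    \<and> (w = 0 \<longrightarrow> S = {}) \<and> (w = 1 \<longrightarrow> S = Z (b t))"
proof -
  have t: "t \<le> m" "Suc t \<le> m" using assms by auto
  have item: "g \<in> X (b t)" "g \<in> \<M>" if "g \<in> Z (b t)" for g using that Z[OF t(1)] ZM[OF t(1)] by blast+
  show ?thesis
    using fraction_subset[of "Z (b t)" "\<lambda>g. share (b t) {g}" "\<lambda>g. share (b (Suc t)) {g}" \<epsilon> w]
      finite_subset[OF ZM[OF t(1)] finite_items] share_item_pos b[OF t(1)] b[OF t(2)] item
      share_item_le eps_pos assms(2,3)
    by (simp add: share_eq_sum[symmetric] kept_def)
qed

lemma long_chain:
  assumes eps: "\<epsilon> < 1 / 64" and L: "1 / (2 * sqrt \<epsilon>) \<le> real L" "real L \<le> 5 / (8 * sqrt \<epsilon>)"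
    and m: "2 * L \<le> m"
  shows "1 / (1 + 8 * sqrt \<epsilon>) \<le> kept 0"
proof (rule ccontr)
  assume neg: "\<not> ?thesis"
  have "real L > 0" using L(1) eps_pos by (smt (verit) divide_pos_pos real_sqrt_gt_zero)
  then have L0: "L > 0" by simp
  have s: "0 < sqrt \<epsilon>" "sqrt \<epsilon> < 1 / 8"
    using eps eps_pos real_less_lsqrt[of "1/8" \<epsilon>] by (auto simp: power2_eq_square)
  have s2: "(sqrt \<epsilon>)\<^sup>2 = \<epsilon>" using eps_pos by simp
  \<comment> \<open>The weights start at \<open>1 / L\<close>, are 1 from \<open>t = L - 1\<close>
    to \<open>t = m - L\<close>, and vanish at \<open>t = m\<close>; neighbouring weights differ by
    at most \<open>1 / L\<close>.\<close>
  define W where "W t = real (min (t + 1) (min L (m - t))) / L" for t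
  have W01: "0 \<le> W t" "W t \<le> 1" for t using L0 by (auto simp: W_def)
  have "\<forall>t. \<exists>S. t < m \<longrightarrow> S \<subseteq> Z (b t) \<and> share (b t) S \<le> W t * kept t + \<epsilon> \<and>
      W t * share (b (Suc t)) (Z (b t)) \<le> share (b (Suc t)) S
    \<and> (W t = 0 \<longrightarrow> S = {}) \<and> (W t = 1 \<longrightarrow> S = Z (b t))"
    using fraction_of_bundle[OF _ W01] by meson
  then obtain S0 where S0: "\<And>t. t < m \<Longrightarrow> S0 t \<subseteq> Z (b t) \<and> share (b t) (S0 t) \<le> W t * kept t + \<epsilon> \<and>
      W t * share (b (Suc t)) (Z (b t)) \<le> share (b (Suc t)) (S0 t)
    \<and> (W t = 0 \<longrightarrow> S0 t = {}) \<and> (W t = 1 \<longrightarrow> S0 t = Z (b t))" by metis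
  define S where "S t = (if t < m then S0 t else {})" for t
  have loss: "share (b t) (S t) \<le> W t * kept t + \<epsilon>" if "t \<le> m" for t
    using that S0[of t] W01[of t] kept_bounds(1)[of t] eps_pos by (auto simp: S_def)
  have gain: "W t * kept (Suc t) \<le> share (b (Suc t)) (S t)" if "t < m" for t
    using that S0[of t] mult_left_mono[OF less_imp_le[OF kept_less[OF that]] W01(1)[of t]] by (auto simp: S_def)
  have full: "share (b t) (S t) = kept t" if "t < m" "W t = 1" for t
    using that S0[of t] by (auto simp: S_def kept_def)
  define F where "F t = 1 - share (b t) (S t) + (if t = 0 then 0 else share (b t) (S (t - 1)))" for t
  \<comment> \<open>Lower bounds for the factors \<open>F t\<close>: on the ramps the change of
    weight contributes \<open>kept t / L\<close> with either sign, and rounding costs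
    \<open>\<epsilon>\<close>. In between whole bundles move, so nothing is lost however long the
    chain is.\<close>
  define c where "c t = (if t < L then 1 - kept t / L - \<epsilon> else if m - L < t then 1 + kept t / L - \<epsilon> else 1)" for t
  have "(\<Prod>t\<le>m. F t) \<le> 1"
    unfolding F_def by (rule chain_exchange) (use S0 in \<open>auto simp: S_def\<close>)
  \<comment> \<open>Agent \<open>t\<close> is less than \<open>L\<close> steps from the start, agent
    \<open>m - t\<close> less than \<open>L\<close> steps from the end, where the kept share is
    1.\<close>
  have pair: "0 < c t" "1 < c t * c (m - t)" if "t < L" for t
  proof -
    have "(1 - real L * \<epsilon>) * kept t \<le> kept 0" using kept_linear[of 0 t L] that m eps by simp
    moreover have "1 - real L * \<epsilon> \<le> kept (m - t)" using kept_linear[of "m - t" t L] that m eps kept_bounds(3) by simp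
    ultimately have "0 < 1 - kept t / L - \<epsilon>" "1 < (1 - kept t / L - \<epsilon>) * (1 + kept (m - t) / L - \<epsilon>)"
      using ramp_factors[of "sqrt \<epsilon>" L "kept 0" "kept t" "kept (m - t)"] s L neg kept_bounds(1)[of 0] kept_bounds(1)[of t] that m
      by (auto simp: s2)
    then show "0 < c t" "1 < c t * c (m - t)" using that m by (auto simp: c_def)
  qed
  have c_nonneg: "0 \<le> c t" if "t \<le> m" for t
    using pair(1)[of t] divide_nonneg_nonneg[OF kept_bounds(1)[OF that], of "real L"] eps
    by (cases "t < L") (auto simp: c_def)
  have "c t \<le> F t" if "t \<le> m" for t
  proof -
    consider "t = 0" | u where "t = Suc u" "t < L" | u where "t = Suc u" "L \<le> t" "t \<le> m - L"
      | u where "t = Suc u" "m - L < t"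
      using that by (cases t) (auto simp: not_less not_le, meson not_less)
    then show ?thesis
    proof cases
      case 1
      have "W 0 = 1 / L" using m L0 by (auto simp: W_def min_def)
      then show ?thesis using 1 loss[of 0] L0 by (simp add: c_def F_def)
    next
      case 2
      have "W t = real (t + 1) / L" "W u = real t / L" using 2 m by (auto simp: W_def min_def)
      then have "W t * kept t = W u * kept t + kept t / L" by (simp add: add_divide_distrib ring_distribs)
      then show ?thesis using 2 loss[OF that] gain[of u] that by (simp add: c_def F_def)
    next
      case 3
      have W: "W t = 1" "W u = 1" using 3 m L0 by (auto simp: W_def min_def)
      then show ?thesis using 3 full[of t] gain[of u] that L0 m by (auto simp: c_def F_def)
    next
      case 4
      have "W t = real (m - t) / L" "W u = real (m - t + 1) / L" using 4 that m by (auto simp: W_def min_def)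
      then have "W t * kept t = W u * kept t - kept t / L" by (simp add: add_divide_distrib ring_distribs)
      moreover have "\<not> t < L" using 4 m by simp
      ultimately show ?thesis using 4 m loss[OF that] gain[of u] that by (simp add: c_def F_def)
    qed
  qed
  then have "(\<Prod>t\<le>m. c t) \<le> (\<Prod>t\<le>m. F t)" using c_nonneg by (intro prod_mono) auto
  moreover have "(\<Prod>t\<le>m. c t) = (\<Prod>t<L. c t * c (m - t))"
  proof -
    have split: "{..m} = ({..<L} \<union> {L..m - L}) \<union> {m - L<..m}" using m L0 by auto
    have "(\<Prod>t\<le>m. c t) = (\<Prod>t\<in>{..<L} \<union> {L..m - L}. c t) * (\<Prod>t\<in>{m - L<..m}. c t)"
      unfolding split using m L0 by (intro prod.union_disjoint) auto
    also have "(\<Prod>t\<in>{..<L} \<union> {L..m - L}. c t) = (\<Prod>t<L. c t) * (\<Prod>t\<in>{L..m - L}. c t)"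
      by (intro prod.union_disjoint) auto
    also have "(\<Prod>t\<in>{L..m - L}. c t) = 1" by (intro prod.neutral) (auto simp: c_def)
    also have "(\<Prod>t\<in>{m - L<..m}. c t) = (\<Prod>t<L. c (m - t))"
      using m by (intro prod.reindex_bij_witness[of _ "\<lambda>t. m - t" "\<lambda>t. m - t"]) auto
    finally show ?thesis by (simp add: prod.distrib)
  qed
  moreover have "1 < (\<Prod>t<L. c t * c (m - t))" using pair(2) L0 by (intro less_1_prod) auto
  ultimately show False using \<open>(\<Prod>t\<le>m. F t) \<le> 1\<close> by simp
qed

lemma kept_0_ge: "1 / (1 + 8 * sqrt \<epsilon>) \<le> kept 0"
proof (cases "\<epsilon> < 1 / 64")
  case False
  \<comment> \<open>In this range the claimed bound is at most 1/2.\<close>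
  then have "1 / 8 \<le> sqrt \<epsilon>" by (intro real_le_rsqrt) (auto simp: power2_eq_square)
  then have "1 / (1 + 8 * sqrt \<epsilon>) \<le> 1 / 2" by (intro divide_left_mono) auto
  then show ?thesis using kept_0_ge_half by simp
next
  case True
  define s where "s = sqrt \<epsilon>"
  have s: "0 < s" "s < 1 / 8"
    using True eps_pos real_less_lsqrt[of "1/8" \<epsilon>] by (auto simp: power2_eq_square s_def)
  have s2: "s\<^sup>2 = \<epsilon>" using eps_pos by (simp add: s_def)
  define L where "L = nat \<lceil>1 / (2 * s)\<rceil>"
  have L1: "1 / (2 * s) \<le> real L" unfolding L_def by (rule real_nat_ceiling_ge)
  \<comment> \<open>Rounding up adds less than 1, which is below \<open>1 / (8 * s)\<close> as
    \<open>s < 1 / 8\<close>; this gives the upper limit \<open>5 / (8 * s)\<close>.\<close>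
  have "real L < 1 / (2 * s) + 1" using s ceiling_correct[of "1 / (2 * s)"] by (simp add: L_def)
  also have "\<dots> \<le> 5 / (8 * s)" using s by (simp add: field_simps)
  finally have L2: "real L \<le> 5 / (8 * s)" by simp
  show ?thesis
  proof (cases "2 * L \<le> m")
    case True
    then show ?thesis using long_chain \<open>\<epsilon> < 1 / 64\<close> L1 L2 by (simp add: s_def)
  next
    case False
    \<comment> \<open>A short chain loses at most \<open>\<epsilon>\<close> per step, in total at
      most \<open>5 / 4 * s\<close>.\<close>
    then have "1 - real (2 * L) * \<epsilon> \<le> kept 0"
      using kept_linear[of 0 m "2 * L"] True kept_bounds(3) by simp
    moreover have "real L * \<epsilon> \<le> 5 / (8 * s) * \<epsilon>" using L2 eps_pos by (intro mult_right_mono) auto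
    moreover have "5 / (8 * s) * \<epsilon> = 5 / 8 * s" using s by (simp add: s2[symmetric] power2_eq_square)
    ultimately have "1 - 5 / 4 * s \<le> kept 0" by simp
    moreover have "1 \<le> (1 - 5 / 4 * s) * (1 + 8 * s)"
    proof -
      have "(1 - 5 / 4 * s) * (1 + 8 * s) = 1 + s * (27 / 4 - 10 * s)" by (simp add: field_simps)
      then show ?thesis using s by simp
    qed
    then have "1 / (1 + 8 * s) \<le> 1 - 5 / 4 * s" using s by (simp add: divide_le_eq)
    ultimately show ?thesis by (simp add: s_def)
  qed
qed

end

section \<open>Total correctness and efficiency\<close>

context market
begin

text \<open>If the demanded bundle were empty, all robust values would be 0 for \<open>i\<close>,
  and \<open>i\<close> would find its own bundle feasible.\<close>

lemma robust_demand_nonempty: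
  assumes valid: "valid_state Z T" and sel: "selectable_matching n v Z T M"
    and i: "i \<in> {1..n}" "i \<notin> fst ` M" and demand: "robust_demand n v Z i j"
  shows "Z j \<noteq> {}"
proof
  assume "Z j = {}"
  then have "robust_value v i (Z k) \<le> 0" if "k \<in> {1..n}" for k
    using demand that by (auto simp: robust_demand_def is_arg_max_linorder robust_value_def[of v i "{}"])
  moreover have "0 \<le> bundle_value v i (Z i)"
    using bundle_value_nonneg[OF i(1) valid_state_subset[OF valid i(1)]] .
  ultimately have "(i, i) \<in> feasibility_graph n v Z"
    using i(1) by (force simp: feasibility_graph_def EFX_feasible_def)
  then show False using unmatched_agent_not_self_feasible[OF sel i(2)] by blast
qed

section \<open>Termination and progress\<close>

text \<open>\<open>P\<close> is an additional loop property of the bundles. The configurations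
  within an iteration remember that their choices came from some selectable matching.\<close>

definition config_ok :: "('a bundles \<Rightarrow> bool) \<Rightarrow> 'a config \<Rightarrow> bool" where
  "config_ok P c = (case c of
      Iteration Z T \<Rightarrow> valid_state Z T \<and> P Z
    | Matched Z T M \<Rightarrow> valid_state Z T \<and> P Z \<and> selectable_matching n v Z T M
    | Unmatched_Agent Z T i \<Rightarrow> valid_state Z T \<and> P Z \<and>
        i \<in> {1..n} \<and> (\<exists>M. selectable_matching n v Z T M \<and> i \<notin> fst ` M)
    | Demand Z T i j \<Rightarrow> valid_state Z T \<and> P Z \<and>
        i \<in> {1..n} \<and> (\<exists>M. selectable_matching n v Z T M \<and> i \<notin> fst ` M) \<and> robust_demand n v Z i j
    | Output Y \<Rightarrow> \<exists>Z T M. valid_state Z T \<and> P Z \<and> covering_matching n v Z T M \<and>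
        card M = n \<and> (\<forall>i j. (i, j) \<in> M \<longrightarrow> Y i = Z j))"

definition items_left :: "'a bundles \<Rightarrow> nat" where
  "items_left Z = (\<Sum>k\<in>{1..n}. card (Z k))"

text \<open>An iteration takes four transitions to the next one; the factor 4 lets one removed item
  pay for them.\<close>

definition rank :: "'a config \<Rightarrow> nat" where
  "rank c = (case c of
      Iteration Z T \<Rightarrow> 4 * items_left Z + 4
    | Matched Z T M \<Rightarrow> 4 * items_left Z + 3
    | Unmatched_Agent Z T i \<Rightarrow> 4 * items_left Z + 2
    | Demand Z T i j \<Rightarrow> 4 * items_left Z + 1
    | Output Y \<Rightarrow> 0)"

lemma items_left_remove:
  assumes "valid_state Z T" "j \<in> {1..n}" "g \<in> Z j"
  shows "items_left (Z(j := Z j - {g})) < items_left Z"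
  unfolding items_left_def
proof (rule sum_strict_mono_ex1)
  have "finite (Z j)" using valid_state_subset[OF assms(1,2)] finite_items by (rule finite_subset)
  then have "card (Z j - {g}) < card (Z j)" using assms(3) by (rule card_Diff1_less)
  then show "\<exists>k\<in>{1..n}. card ((Z(j := Z j - {g})) k) < card (Z k)"
    "\<forall>k\<in>{1..n}. card ((Z(j := Z j - {g})) k) \<le> card (Z k)"
    using assms(2) by auto
qed simp

text \<open>To restore \<open>P\<close>, \<open>preserve\<close> may use a matching that gives the
  shrunken bundle \<open>j\<close> to another agent \<open>i\<close>. It need not be the matching
  chosen in the next iteration.\<close>

lemma config_ok_step:
  assumes preserve: "\<And>Z T j g M i. valid_state Z T \<Longrightarrow> P Z \<Longrightarrow>
      valid_state (Z(j := Z j - {g})) (insert j T) \<Longrightarrow>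
      covering_matching n v (Z(j := Z j - {g})) (insert j T) M \<Longrightarrow> (i, j) \<in> M \<Longrightarrow> i \<noteq> j \<Longrightarrow>
      P (Z(j := Z j - {g}))"
    and "step n v c c'" "config_ok P c"
  shows "config_ok P c' \<and> rank c' < rank c"
  using assms(2,3)
proof cases
  case (remove_item i Z j g T)
  obtain M where valid: "valid_state Z T" and P: "P Z" and i: "i \<in> {1..n}" "i \<notin> fst ` M"
    and M: "selectable_matching n v Z T M" and demand: "robust_demand n v Z i j"
    using assms(3) remove_item by (auto simp: config_ok_def)
  have g: "g \<in> Z j" using remove_item by (simp add: is_arg_min_def)
  have j: "j \<in> {1..n}" using demand by (simp add: robust_demand_def is_arg_max_def)
  obtain M' where M': "covering_matching n v (Z(j := Z j - {g})) (insert j T) M'" "(i, j) \<in> M'" "i \<noteq> j"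
    using remove_item_matching[OF valid M i demand] remove_item by blast
  have "valid_state (Z(j := Z j - {g})) (insert j T)"
    using valid j M'(1) unfolding valid_state_def by (intro conjI exI[of _ M']) auto
  moreover from this have "P (Z(j := Z j - {g}))" using preserve[OF valid P _ M'] by blast
  moreover have "items_left (Z(j := Z j - {g})) < items_left Z" using valid j g by (rule items_left_remove)
  ultimately show ?thesis using remove_item by (simp add: config_ok_def rank_def)
next
  case (stop M Y Z T)
  then have "valid_state Z T" "P Z" "covering_matching n v Z T M"
    using assms(3) selectable_matchingD(1) by (auto simp: config_ok_def)
  then have "\<exists>Z T M. valid_state Z T \<and> P Z \<and> covering_matching n v Z T M \<and> card M = n \<and>
      (\<forall>i j. (i, j) \<in> M \<longrightarrow> Y i = Z j)"
    using stop by blast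
  then show ?thesis using stop by (simp add: config_ok_def rank_def)
qed (auto simp: config_ok_def rank_def)

lemma config_ok_progress:
  assumes "config_ok P c" "\<nexists>c'. step n v c c'"
  shows "\<exists>Y. c = Output Y"
proof (cases c)
  case (Iteration Z T)
  then obtain M where "selectable_matching n v Z T M"
    using assms(1) selectable_matching_exists by (auto simp: config_ok_def)
  then show ?thesis using assms(2) Iteration choose_matching by blast
next
  case (Matched Z T M)
  have "covering_matching n v Z T M"
    using assms(1) Matched selectable_matchingD(1) by (auto simp: config_ok_def)
  then have M: "inj_on fst M" "inj_on snd M" "fst ` M \<subseteq> {1..n}"
    by (auto simp: covering_matching_def matching_def feasibility_graph_def)
  show ?thesis
  proof (cases "card M = n")
    case True
    \<comment> \<open>Each agent has at most one partner in \<open>M\<close>, so the demands on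
      \<open>Y\<close> are consistent.\<close>
    have "\<forall>i. \<exists>S. \<forall>j. (i, j) \<in> M \<longrightarrow> S = Z j"
      using M(1) by (metis fst_conv inj_onD prod.inject)
    then obtain Y where "\<And>i j. (i, j) \<in> M \<Longrightarrow> Y i = Z j" by metis
    then show ?thesis using assms(2) Matched stop[OF True] by blast
  next
    case False
    have "fst ` M \<noteq> {1..n}" using False card_image[OF M(1)] by auto
    then obtain i where "i \<in> {1..n}" "i \<notin> fst ` M" using M(3) by blast
    then show ?thesis using assms(2) Matched choose_agent[OF False] by blast
  qed
next
  case (Unmatched_Agent Z T i)
  then have "i \<in> {1..n}" using assms(1) by (simp add: config_ok_def)
  then have "finite {1..n}" "{1..n} \<noteq> {}" by auto
  then obtain j where j: "is_arg_min (\<lambda>j. - robust_value v i (Z j)) (\<lambda>j. j \<in> {1..n}) j"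
    using ex_is_arg_min_if_finite by blast
  have "robust_demand n v Z i j"
    using j by (simp add: robust_demand_def is_arg_max_linorder is_arg_min_linorder)
  then show ?thesis using assms(2) Unmatched_Agent choose_demand by blast
next
  case (Demand Z T i j)
  then obtain M where valid: "valid_state Z T" and i: "i \<in> {1..n}" "i \<notin> fst ` M"
    and M: "selectable_matching n v Z T M" and demand: "robust_demand n v Z i j"
    using assms(1) by (auto simp: config_ok_def)
  have j: "j \<in> {1..n}" using demand by (simp add: robust_demand_def is_arg_max_def)
  have "finite (Z j)" using valid_state_subset[OF valid j] finite_items by (rule finite_subset)
  then obtain g where "is_arg_min (v i) (\<lambda>g. g \<in> Z j) g"
    using ex_is_arg_min_if_finite[of "Z j" "v i"] robust_demand_nonempty[OF valid M i demand] by blast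
  then have "step n v c (Iteration (Z(j := Z j - {g})) (insert j T))"
    unfolding Demand by (rule remove_item)
  then show ?thesis using assms(2) by blast
qed blast

text \<open>The decreasing \<open>rank\<close> excludes infinite runs, and progress shows that a run
  can only get stuck at an output.\<close>

lemma algorithm_outputs_invariant:
  assumes "P X"
    and preserve: "\<And>Z T j g M i. valid_state Z T \<Longrightarrow> P Z \<Longrightarrow>
      valid_state (Z(j := Z j - {g})) (insert j T) \<Longrightarrow>
      covering_matching n v (Z(j := Z j - {g})) (insert j T) M \<Longrightarrow> (i, j) \<in> M \<Longrightarrow> i \<noteq> j \<Longrightarrow>
      P (Z(j := Z j - {g}))"
    and post: "\<And>Z T M Y. valid_state Z T \<Longrightarrow> P Z \<Longrightarrow> covering_matching n v Z T M \<Longrightarrow> card M = n \<Longrightarrow>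
      (\<And>i j. (i, j) \<in> M \<Longrightarrow> Y i = Z j) \<Longrightarrow> Q Y"
  shows "algorithm_outputs n v X Q"
proof -
  have ok_step: "config_ok P c' \<and> rank c' < rank c" if "step n v c c'" "config_ok P c" for c c'
    using preserve that by (rule config_ok_step)
  have initial: "config_ok P (initial X)"
    using assms(1) valid_state_initial by (simp add: config_ok_def initial_def)
  have "False" if "c 0 = initial X" and steps: "\<And>k. step n v (c k) (c (Suc k))" for c :: "nat \<Rightarrow> 'a config"
  proof -
    have "config_ok P (c k) \<and> rank (c k) + k \<le> rank (c 0)" for k
    proof (induction k)
      case (Suc k)
      then show ?case using ok_step[OF steps[of k]] by auto
    qed (use initial that(1) in simp)
    from this[of "Suc (rank (c 0))"] show False by simp
  qed
  moreover have "\<exists>Y. c = Output Y \<and> Q Y" if "(step n v)\<^sup>*\<^sup>* (initial X) c" "\<nexists>c'. step n v c c'" for c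
  proof -
    have ok: "config_ok P c" using that(1) initial by induction (auto dest: ok_step)
    then have "\<exists>Y. c = Output Y" using that(2) by (rule config_ok_progress)
    then obtain Y where Y: "c = Output Y" by blast
    then obtain Z T M where "valid_state Z T" "P Z" "covering_matching n v Z T M" "card M = n"
      "\<forall>i j. (i, j) \<in> M \<longrightarrow> Y i = Z j"
      using ok by (auto simp: config_ok_def)
    then show ?thesis using post[of Z T M Y] Y by blast
  qed
  ultimately show ?thesis unfolding algorithm_outputs_def by blast
qed

section \<open>Properties of the returned allocation\<close>

lemma perfect_matching_partner:
  assumes "covering_matching n v Z T M" "card M = n" "i \<in> {1..n}"
  shows "\<exists>j. (i, j) \<in> M \<and> (i, j) \<in> feasibility_graph n v Z"
proof -
  have M: "M \<subseteq> feasibility_graph n v Z" "inj_on fst M" "fst ` M \<subseteq> {1..n}"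
    using assms(1) by (auto simp: covering_matching_def matching_def feasibility_graph_def)
  then have "fst ` M = {1..n}" using assms(2) card_image[OF M(2)] by (intro card_subset_eq) auto
  then show ?thesis using assms(3) M(1) by (metis imageE prod.collapse subsetD)
qed

lemma output_allocation:
  assumes valid: "valid_state Z T" and M: "covering_matching n v Z T M" "card M = n"
    and Y: "\<And>i j. (i, j) \<in> M \<Longrightarrow> Y i = Z j"
  shows "\<exists>S\<subseteq>\<M>. allocation n S Y"
proof (intro exI[of _ "\<Union>i\<in>{1..n}. Y i"] conjI)
  have partner: "\<exists>j\<in>{1..n}. (i, j) \<in> M \<and> Y i = Z j \<and> Z j \<subseteq> X j \<and> Z j \<subseteq> \<M>" if i: "i \<in> {1..n}" for i
  proof -
    obtain j where j: "(i, j) \<in> M" "(i, j) \<in> feasibility_graph n v Z"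
      using perfect_matching_partner[OF M i] by blast
    have "j \<in> {1..n}" using j(2) by (simp add: feasibility_graph_def)
    moreover from this have "Z j \<subseteq> X j" using valid by (simp add: valid_state_def)
    ultimately show ?thesis using j(1) Y[OF j(1)] valid_state_subset[OF valid] by blast
  qed
  show "(\<Union>i\<in>{1..n}. Y i) \<subseteq> \<M>" using partner by fast
  have "Y i \<inter> Y k = {}" if ik: "i \<in> {1..n}" "k \<in> {1..n}" "i \<noteq> k" for i k
  proof -
    obtain j l where j: "j \<in> {1..n}" "(i, j) \<in> M" "Y i = Z j" "Z j \<subseteq> X j"
      and l: "l \<in> {1..n}" "(k, l) \<in> M" "Y k = Z l" "Z l \<subseteq> X l"
      using partner ik(1,2) by meson
    have "j \<noteq> l"
      using M(1) inj_onD[of snd M "(i, j)" "(k, l)"] j(2) l(2) ik(3)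
      by (auto simp: covering_matching_def matching_def)
    then have "X j \<inter> X l = {}" using j(1) l(1) X_eq by blast
    then show ?thesis using j(3,4) l(3,4) by blast
  qed
  then show "allocation n (\<Union>i\<in>{1..n}. Y i) Y"
    by (simp add: allocation_def disjoint_family_on_def)
qed

lemma output_EFX:
  assumes M: "covering_matching n v Z T M" "card M = n"
    and Y: "\<And>i j. (i, j) \<in> M \<Longrightarrow> Y i = Z j"
  shows "EFX n v Y"
  unfolding EFX_def
proof (intro ballI)
  fix i k assume "i \<in> {1..n}" "k \<in> {1..n}"
  then obtain j l where "(i, j) \<in> M" "(i, j) \<in> feasibility_graph n v Z"
    "(k, l) \<in> M" "(k, l) \<in> feasibility_graph n v Z"
    using perfect_matching_partner[OF M, of i] perfect_matching_partner[OF M, of k] by blast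
  then show "robust_value v i (Y k) \<le> bundle_value v i (Y i)"
    using Y by (auto simp: feasibility_graph_def EFX_feasible_def)
qed

text \<open>This is the purpose of condition (ii) in the graph: an agent leaves its own bundle only
  for a better one.\<close>

lemma output_value_ge:
  assumes M: "covering_matching n v Z T M" "card M = n"
    and Y: "\<And>i j. (i, j) \<in> M \<Longrightarrow> Y i = Z j" and i: "i \<in> {1..n}"
  shows "bundle_value v i (Z i) \<le> bundle_value v i (Y i)"
proof -
  obtain j where "(i, j) \<in> M" "(i, j) \<in> feasibility_graph n v Z"
    using perfect_matching_partner[OF M i] by blast
  then show ?thesis using Y[of i j] by (cases "i = j") (auto simp: feasibility_graph_def)
qed

end

section \<open>Efficiency\<close>

context large_market
begin

text \<open>The orbit of \<open>j\<close> under the map from touched bundles to their matched agents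
  either reaches an untouched bundle, which gives an improvement chain, or closes up, which
  contradicts optimality.\<close>

lemma rematched_share_ge:
  assumes valid: "valid_state Z T" and M: "covering_matching n v Z T M"
    and ij: "(i, j) \<in> M" "i \<noteq> j" "j \<in> T"
  shows "1 / (1 + 8 * sqrt \<epsilon>) \<le> share j (Z j)"
proof -
  \<comment> \<open>Meaningful for \<open>k\<close> in \<open>T\<close>, where a partner exists; it
    is unique because \<open>M\<close> is injective on bundles.\<close>
  define f where "f k = (SOME a. (a, k) \<in> M)" for k
  have T: "T \<subseteq> {1..n}" and ZX: "\<And>k. k \<in> {1..n} \<Longrightarrow> Z k \<subseteq> X k"
    and untouched: "\<And>k. k \<in> {1..n} \<Longrightarrow> k \<notin> T \<Longrightarrow> Z k = X k"
    using valid by (auto simp: valid_state_def)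
  have MG: "M \<subseteq> feasibility_graph n v Z" and inj: "inj_on fst M" "inj_on snd M" and TM: "T \<subseteq> snd ` M"
    using M by (auto simp: covering_matching_def matching_def)
  have f: "(f k, k) \<in> M" if "k \<in> T" for k
  proof -
    have "\<exists>a. (a, k) \<in> M" using TM that by force
    then show ?thesis unfolding f_def by (rule someI_ex)
  qed
  have f_range: "f k \<in> {1..n}" if "k \<in> T" for k using f[OF that] MG by (auto simp: feasibility_graph_def)
  have better: "bundle_value v (f k) (Z (f k)) < bundle_value v (f k) (Z k)" if "k \<in> T" "f k \<noteq> k" for k
    using f[OF that(1)] MG that(2) by (auto simp: feasibility_graph_def)
  have inj_f: "inj_on f T"
  proof (rule inj_onI)
    fix k l assume "k \<in> T" "l \<in> T" "f k = f l"
    then show "k = l" using inj_onD[OF inj(1), of "(f k, k)" "(f l, l)"] f[of k] f[of l] by simp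
  qed
  have "f j = i" using inj_onD[OF inj(2), of "(f j, j)" "(i, j)"] f[OF ij(3)] ij by simp
  then have "f j \<noteq> j" using ij by simp
  moreover have "finite T" using T by (rule finite_subset) simp
  ultimately show ?thesis
  proof (cases rule: orbit_exits_or_cycles[OF _ inj_f ij(3), case_names finite moved path cycle])
    case (path m)
    define b where "b = (\<lambda>t. (f ^^ t) j)"
    have bT: "b t \<in> T" if "t < m" for t using path(3) that by (simp add: b_def)
    have b_Suc: "b (Suc t) = f (b t)" for t by (simp add: b_def)
    have b: "b t \<in> {1..n}" if "t \<le> m" for t
      using that ij(3) T bT f_range by (cases t) (auto simp: b_Suc, auto simp: b_def)
    interpret improvement_chain n v \<M> X \<epsilon> Z b m
    proof
      show inj_b: "inj_on b {..m}" using path(2) by (simp add: b_def)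
      show "Z (b m) = X (b m)" using untouched[OF b] path(4) by (simp add: b_def)
      show "bundle_value v (b (Suc t)) (Z (b (Suc t))) < bundle_value v (b (Suc t)) (Z (b t))" if "t < m" for t
      proof -
        \<comment> \<open>The chain has no fixed point, so each of its edges is off the diagonal and
          carries a strict preference.\<close>
        have "b (Suc t) \<noteq> b t" using inj_onD[OF inj_b, of "Suc t" t] that by auto
        then show ?thesis using better[OF bT[OF that]] by (simp add: b_Suc)
      qed
    qed (use b ZX path(1) in auto)
    have "b 0 = j" by (simp add: b_def)
    then show ?thesis using kept_0_ge unfolding kept_def by simp
  next
    case (cycle m)
    define b where "b = (\<lambda>t. (f ^^ t) j)"
    define pre where "pre t = (if t = 0 then m else t - 1)" for t
    have inj_b: "inj_on b {..m}" using cycle(2) by (simp add: b_def)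
    have bT: "b t \<in> T" if "t \<le> m" for t using cycle(3) that by (simp add: b_def)
    then have b: "b t \<in> {1..n}" if "t \<le> m" for t using T that by blast
    have b_pre: "b t = f (b (pre t))" for t using cycle(4) by (cases t) (auto simp: b_def pre_def)
    have pre: "pre t \<le> m" "pre t \<noteq> t" if "t \<le> m" for t using that cycle(1) by (auto simp: pre_def)
    \<comment> \<open>Each agent on the cycle passes on its current bundle, keeps what had been
      removed from it, and receives a bundle it prefers.\<close>
    have "(\<Prod>t\<le>m. 1 - share (b t) (Z (b t)) + share (b t) (Z (b (pre t)))) \<le> 1"
      unfolding pre_def by (rule cyclic_exchange[OF inj_b b, where S = "\<lambda>t. Z (b t)"]) (use b ZX in auto)
    moreover have "1 < (\<Prod>t\<le>m. 1 - share (b t) (Z (b t)) + share (b t) (Z (b (pre t))))"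
    proof (rule less_1_prod)
      fix t assume "t \<in> {..m}"
      then have t: "t \<le> m" by simp
      have "b t \<noteq> b (pre t)" using inj_onD[OF inj_b, of t "pre t"] pre[OF t] t by auto
      then have "share (b t) (Z (b t)) < share (b t) (Z (b (pre t)))"
        using better[OF bT[OF pre(1)[OF t]]] b_pre[of t] share_less_iff[OF b[OF t]] by simp
      then show "1 < 1 - share (b t) (Z (b t)) + share (b t) (Z (b (pre t)))" by simp
    qed auto
    ultimately show ?thesis by simp
  qed
qed

lemma efficient_if_share_ge:
  assumes "\<And>i. i \<in> {1..n} \<Longrightarrow> 1 / (1 + 8 * sqrt \<epsilon>) \<le> share i (Y i)"
  shows "efficient n v \<M> (1 + 8 * sqrt \<epsilon>) Y"
proof -
  define c where "c = 1 + 8 * sqrt \<epsilon>"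
  have c: "c > 0" using eps_pos by (simp add: c_def add_pos_nonneg)
  have "0 \<le> bundle_value v i (X i) \<and> bundle_value v i (X i) \<le> c * bundle_value v i (Y i)"
    if "i \<in> {1..n}" for i
    using assms[OF that] bundle_value_X_pos[OF that] c by (simp add: share_def c_def field_simps)
  then have "(\<Prod>i\<in>{1..n}. bundle_value v i (X i)) \<le> (\<Prod>i\<in>{1..n}. c * bundle_value v i (Y i))"
    by (intro prod_mono)
  also have "\<dots> = c powr real n * (\<Prod>i\<in>{1..n}. bundle_value v i (Y i))"
    using c by (simp add: prod.distrib powr_realpow)
  finally have le: "(\<Prod>i\<in>{1..n}. bundle_value v i (X i))
      \<le> c powr real n * (\<Prod>i\<in>{1..n}. bundle_value v i (Y i))" .
  have pos: "0 \<le> (\<Prod>i\<in>{1..n}. bundle_value v i (X i))"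
    using bundle_value_X_pos by (intro prod_nonneg) (auto intro: less_imp_le)
  have "NW n v X \<le> (c powr real n * (\<Prod>i\<in>{1..n}. bundle_value v i (Y i))) powr (1 / real n)"
    unfolding NW_def using pos le by (intro powr_mono2) auto
  also have "\<dots> = c * NW n v Y"
    using c agents by (simp add: NW_def powr_mult powr_powr)
  finally show ?thesis using optimal by (simp add: efficient_def c_def)
qed

text \<open>The invariant bounds the share of every \<open>Z k\<close> for its original owner. Only
  the bundle just shrunk needs a new argument, and at that moment it can be matched to another
  agent. At the end every agent gets at least the value of its own remaining bundle.\<close>

lemma algorithm_outputs_efficient:
  "algorithm_outputs n v X
    (\<lambda>Y. (\<exists>S. S \<subseteq> \<M> \<and> allocation n S Y) \<and> EFX n v Y \<and> efficient n v \<M> (1 + 8 * sqrt \<epsilon>) Y)"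
proof (rule algorithm_outputs_invariant[where P = "\<lambda>Z. \<forall>k\<in>{1..n}. 1 / (1 + 8 * sqrt \<epsilon>) \<le> share k (Z k)"])
  have "sqrt \<epsilon> > 0" using eps_pos by simp
  then have "1 / (1 + 8 * sqrt \<epsilon>) \<le> 1" by (subst divide_le_eq_1_pos) linarith+
  then show "\<forall>k\<in>{1..n}. 1 / (1 + 8 * sqrt \<epsilon>) \<le> share k (X k)" by (simp add: share_X)
next
  fix Z T j g M i
  assume P: "\<forall>k\<in>{1..n}. 1 / (1 + 8 * sqrt \<epsilon>) \<le> share k (Z k)"
    and valid: "valid_state (Z(j := Z j - {g})) (insert j T)"
    and M: "covering_matching n v (Z(j := Z j - {g})) (insert j T) M" "(i, j) \<in> M" "i \<noteq> j"
  show "\<forall>k\<in>{1..n}. 1 / (1 + 8 * sqrt \<epsilon>) \<le> share k ((Z(j := Z j - {g})) k)"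
  proof
    fix k assume "k \<in> {1..n}"
    then show "1 / (1 + 8 * sqrt \<epsilon>) \<le> share k ((Z(j := Z j - {g})) k)"
      using P rematched_share_ge[OF valid M] by (cases "k = j") simp_all
  qed
next
  fix Z T M Y
  assume P: "\<forall>k\<in>{1..n}. 1 / (1 + 8 * sqrt \<epsilon>) \<le> share k (Z k)"
    and valid: "valid_state Z T"
    and M: "covering_matching n v Z T M" "card M = n" and Y: "\<And>i j. (i, j) \<in> M \<Longrightarrow> Y i = Z j"
  have "efficient n v \<M> (1 + 8 * sqrt \<epsilon>) Y"
  proof (rule efficient_if_share_ge)
    fix i assume i: "i \<in> {1..n}"
    have "share i (Z i) \<le> share i (Y i)"
      using output_value_ge[of Z T M Y, OF M Y i] bundle_value_X_pos[OF i] by (simp add: share_def divide_right_mono)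
    then show "1 / (1 + 8 * sqrt \<epsilon>) \<le> share i (Y i)" using P i by force
  qed
  then show "(\<exists>S. S \<subseteq> \<M> \<and> allocation n S Y) \<and> EFX n v Y \<and> efficient n v \<M> (1 + 8 * sqrt \<epsilon>) Y"
    using output_allocation[of Z T M Y, OF valid M Y] output_EFX[of Z T M Y, OF M Y] by blast
qed

end

theorem theorem4:
  fixes n :: nat and \<M> :: "'a set" and v :: "nat \<Rightarrow> 'a \<Rightarrow> real"
    and \<epsilon> :: real and X :: "nat \<Rightarrow> 'a set"
  assumes "n \<ge> 1"
    and "finite \<M>"
    and "\<And>i g. i \<in> {1..n} \<Longrightarrow> g \<in> \<M> \<Longrightarrow> v i g > 0"
    and "\<epsilon> > 0"
    and "allocation n \<M> X"
    and "NW n v X = opt_NW n v \<M>"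
    and "\<And>i g. i \<in> {1..n} \<Longrightarrow> g \<in> X i \<Longrightarrow> v i g \<le> \<epsilon> * bundle_value v i (X i)"
  shows "algorithm_outputs n v X
    (\<lambda>Y. (\<exists>S. S \<subseteq> \<M> \<and> allocation n S Y) \<and> EFX n v Y \<and> efficient n v \<M> (1 + 8 * sqrt \<epsilon>) Y)"
proof (cases "NW n v X > 0")
  case True
  interpret large_market n v \<M> X \<epsilon>
    by unfold_locales (use assms True in auto)
  show ?thesis by (rule algorithm_outputs_efficient)
next
  \<comment> \<open>The optimum is 0 here, so efficiency is trivial; termination and EFX follow with
    the trivial loop property.\<close>
  case False
  interpret market n v \<M> X
    by unfold_locales (use assms in auto)
  have "NW n v Y \<ge> 0" for Y by (simp add: NW_def)
  then have efficient: "efficient n v \<M> (1 + 8 * sqrt \<epsilon>) Y" for Y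
    using False assms(4,6) unfolding efficient_def
    by (smt (verit) mult_nonneg_nonneg real_sqrt_ge_zero)
  show ?thesis
    by (rule algorithm_outputs_invariant[where P = "\<lambda>_. True"])
      (use efficient output_allocation output_EFX in blast)+
qed

end
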